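(* Fix $b\in(0,1)$, an integer $N>0$ and $t>0$. Let $N$ particles start at $\vec y=(y_1<\dots<y_N)\in X^N$ and evolve as HL-PushTASEP on $\mathbb{Z}_{\geq0}$ with parameter $b$. Then for $1\le m\le N$ and $x\in\mathbb{Z}$, \begin{align*} P_{\vec y}(x_m(t)=x)&=(-1)^{m-1}b^{m(m-1)/2}\sum_{k=m}^N\sum_{S\subset\{1,\dots,N\},|S|=k}b^{\kappa(S)-mk-k(k-1)/2}\binom{k-1}{m-1}_b\\ &\quad\times\frac{1}{(2\pi i)^k}\oint\cdots\oint\prod_{i,j\in S,i<j}\frac{z_j-z_i}{1-(1+b^{-1})z_i+b^{-1}z_iz_j}\cdot\frac{1-\prod_{i\in S}z_i}{\prod_{i\in S}(1-z_i)}\prod_{i\in S}z_i^{x-y_i-1}\exp\left(-t\frac{1-z_i^{-1}}{1-bz_i^{-1}}\right)dz_i, \end{align*} where $\kappa(S)$ is the sum of the elements of $S$ and the contours are positively oriented circles of equal large radius containing all singularities of the integrand.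
   Context: $X^N=\{(x_1<\dots<x_N):x_i\in\mathbb{Z}_{\geq0}\}$. HL-PushTASEP on $\mathbb{Z}_{\geq 0}$ with parameter $b$: each particle has an independent rate-$1$ exponential clock; when the clock of the particle at $x_m$ rings, it jumps $j$ steps to the right with probability $(1-b)b^{j-1}$ for $1\leq j<x_{m+1}-x_m$, and with probability $b^{x_{m+1}-x_m-1}$ it reaches $x_{m+1}$, occupies it, and the particle previously at $x_{m+1}$ is instantaneously activated and moves by the same rule. $x_m(t)$ is the position of the $m$-th particle from the left at time $t$. $\binom{n}{k}_q=\frac{(q^{n-k+1};q)_k}{(q;q)_k}$ with $(a;q)_k=\prod_{j=1}^k(1-aq^{j-1})$. *)

theory Defs
  imports "HOL-Probability.Probability" "HOL-Complex_Analysis.Complex_Analysis"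
begin

text \<open>Configurations: a list xs of length N, strictly increasing; xs ! (m-1) is the
position of the m-th particle from the left (1-based m).\<close>

text \<open>Activation of the particle with 0-based index i in configuration xs
(HL-PushTASEP rule). The tentative jump is j = 1 + G with G geometric,
P(G = g) = (1-b) b^g, so P(j = J) = (1-b) b^(J-1). If j reaches the gap
to the next particle, the particle lands on the next particle's site, and the
next particle is activated (pushed) and moves by the same rule. The rightmost
particle has no right neighbour.\<close>

function hl_activate :: "real \<Rightarrow> nat list \<Rightarrow> nat \<Rightarrow> nat list pmf" where
  "hl_activate b xs i =
     (if length xs \<le> i then return_pmf xs
      else bind_pmf (geometric_pmf (1 - b)) (\<lambda>g.
        (if Suc i < length xs \<and> xs ! (Suc i) \<le> xs ! i + Suc g
         then hl_activate b (xs[i := xs ! Suc i]) (Suc i)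
         else return_pmf (xs[i := xs ! i + Suc g]))))"
  by auto
termination
  by (relation "Wellfounded.measure (\<lambda>(b, xs, i). length xs - i)") auto

definition hl_ring :: "real \<Rightarrow> nat list \<Rightarrow> nat list pmf" where
  "hl_ring b xs = bind_pmf (pmf_of_set {..<length xs}) (hl_activate b xs)"

text \<open>Law of the configuration at time t started from y: N independent rate-1
clocks superpose to a rate-N Poisson process of rings, each ring belonging to a
uniformly chosen particle independently; so the number of rings up to time t is
Poisson(N t) and the configuration is the n-fold iterate of hl_ring.\<close>
definition hl_pushtasep_law :: "real \<Rightarrow> real \<Rightarrow> nat list \<Rightarrow> nat list pmf" where
  "hl_pushtasep_law b t y =
     bind_pmf (poisson_pmf (real (length y) * t))
       (\<lambda>n. ((\<lambda>p. bind_pmf p (hl_ring b)) ^^ n) (return_pmf y))"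

definition qpoch :: "'a::comm_ring_1 \<Rightarrow> 'a \<Rightarrow> nat \<Rightarrow> 'a" where
  "qpoch a q k = (\<Prod>j=1..k. 1 - a * q ^ (j - 1))"

definition qbinom :: "'a::field \<Rightarrow> nat \<Rightarrow> nat \<Rightarrow> 'a" where
  "qbinom q n k = qpoch (q ^ (n - k + 1)) q k / qpoch q q k"

fun multi_circle_integral :: "real \<Rightarrow> nat list \<Rightarrow> ((nat \<Rightarrow> complex) \<Rightarrow> complex) \<Rightarrow> complex" where
  "multi_circle_integral R [] F = F (\<lambda>_. 0)"
| "multi_circle_integral R (i # is) F =
     (1 / (2 * pi * \<i>)) * contour_integral (circlepath 0 R)
        (\<lambda>w. multi_circle_integral R is (\<lambda>z. F (z(i := w))))"

definition hl_integrand :: "real \<Rightarrow> real \<Rightarrow> nat list \<Rightarrow> int \<Rightarrow> nat set \<Rightarrow> (nat \<Rightarrow> complex) \<Rightarrow> complex" where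
  "hl_integrand b t y x S z =
     (\<Prod>i\<in>S. \<Prod>j\<in>S. if i < j then
         (z j - z i) / (1 - (1 + 1 / of_real b) * z i + (1 / of_real b) * z i * z j) else 1)
     * ((1 - (\<Prod>i\<in>S. z i)) / (\<Prod>i\<in>S. (1 - z i)))
     * (\<Prod>i\<in>S. z i powi (x - int (y ! (i - 1)) - 1)
          * exp (- of_real t * (1 - 1 / z i) / (1 - of_real b / z i)))"

definition kappa :: "nat set \<Rightarrow> nat" where
  "kappa S = \<Sum>S"

end

(* The jump law of a particle acts on z^(-y), written with u = 1/z, by the factor
   (1 - b) u / (1 - b u), and the kernel becomes K(x,v) = b (x - v) / D(x,v) with
   D(x,v) = 1 - (1 + b) v + b x v.  The right-hand side, with y variable, is a combination of torus means on
   which the pushing rule is equivalent to free jumps: at y_i = y_(i+1) the boundary condition holds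
   because D(u_i, u_(i+1)) cancels the denominator of the kernel and leaves an antisymmetric
   integrand, while the sets containing exactly one of i, i+1 cancel through the weight
   b^kappa(S).  Hence one ring of the clocks multiplies the integrand by a scalar, the Poisson number
   of rings sums to the exponential, and only time 0 remains.  There each integral is a power series
   coefficient; expanding K(x,v) = b - b (1 - x) (1 - b v) / D(x,v) in the variable of the smallest
   index, every term except the constant one vanishes, because the particles are ordered.  What is
   left is a q-binomial identity in the number of particles not to the right of x. *)
theory Submission
  imports Defs
begin

section \<open>Means over circles and tori\<close>

text \<open>The vanishing at time 0 is the hard point. For the smallest index s, a subset J of the
  other indices contributes denominators \<open>D (u s) (u j)\<close> that all share
  \<open>u s\<close>, together with |J| factors \<open>1 - u s\<close>, which would lower the
  negative power of \<open>u s\<close> on which the argument depends. One of these factors cancels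
  the \<open>1 / (1 - u s)\<close> of the integrand. Each of the other |J| - 1 is consumed, along
  with a difference \<open>u i - u j\<close> from the kernels inside J, by a partial fraction in
  \<open>u s\<close> that removes one denominator. A single \<open>1 / D (u s) (u j)\<close> is
  left; in its expansion the k-th power of \<open>u s\<close> carries the k-th power of
  \<open>u j\<close>, and y_s < y_j then forces a zero coefficient. In the dynamics the memoryless
  geometric law does the work: a free jump that reaches the next particle restarts there, so pushing
  and free motion have to be compared only for two equal positions. Small circles, |u| < 1/3, keep
  every denominator away from 0 and bound all powers u^y by 1, so that expectations over infinitely
  many configurations can be exchanged with integrals.\<close>

definition circle_mean :: "real \<Rightarrow> (complex \<Rightarrow> complex) \<Rightarrow> complex" where
  "circle_mean r h = integral {0..1} (\<lambda>\<theta>. h (circlepath 0 r \<theta>))"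

lemma circlepath_0: "circlepath 0 r \<theta> = of_real r * exp (2 * of_real pi * \<i> * of_real \<theta>)"
  by (simp add: circlepath)

lemma norm_circlepath_0: "0 < r \<Longrightarrow> cmod (circlepath 0 r \<theta>) = r"
  by (simp add: circlepath_0 norm_mult)

text \<open>On the circle, dw is 2 pi i w times the differential of \<theta>. Means are preferred to
  contour integrals because they do not see the orientation, which the substitution of 1/w for w
  reverses.\<close>

lemma contour_integral_eq_circle_mean:
  "contour_integral (circlepath 0 r) f = 2 * of_real pi * \<i> * circle_mean r (\<lambda>w. f w * w)"
  unfolding contour_integral_integral circle_mean_def
    vector_derivative_circlepath circlepath_0
  by (subst Henstock_Kurzweil_Integration.integral_mult_right [symmetric])
    (auto intro!: Henstock_Kurzweil_Integration.integral_cong simp: algebra_simps)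

lemma integral_reflect_unit_interval:
  fixes f :: "real \<Rightarrow> complex"
  shows "integral {0..1} (\<lambda>x. f (1 - x)) = integral {0..1} f"
proof -
  have *: "((\<lambda>x. f (1 - x)) has_integral I) {0..1}" if "(f has_integral I) {0..1}" for f :: "real \<Rightarrow> complex" and I
  proof -
    have im: "(\<lambda>x. (1 / (-1)) *\<^sub>R x + - ((1 / (-1)) *\<^sub>R 1)) ` cbox 0 (1::real) = {0..1}"
      by (auto simp: image_iff intro: bexI[of _ "1 - _"])
    show ?thesis
      using has_integral_affinity[of f I 0 1 "-1" 1] that unfolding im by simp
  qed
  \<comment> \<open>An equivalence for every \<open>I\<close> also transfers the default value that
    \<open>integral\<close> takes on a function that is not integrable.\<close>
  have "((\<lambda>x. f (1 - x)) has_integral I) {0..1} \<longleftrightarrow> (f has_integral I) {0..1}" for I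
    using *[of f I] *[of "\<lambda>x. f (1 - x)" I] by auto
  then show ?thesis
    unfolding integral_def integrable_on_def by simp
qed

lemma circle_mean_inverse:
  assumes "0 < r"
  shows "circle_mean r (\<lambda>w. h (inverse w)) = circle_mean (1 / r) h"
proof -
  have "inverse (circlepath 0 r \<theta>) = circlepath 0 (1 / r) (1 - \<theta>)" for \<theta>
    using assms by (simp add: circlepath_0 exp_minus exp_diff field_simps exp_two_pi_i)
  then show ?thesis
    unfolding circle_mean_def
    using integral_reflect_unit_interval[of "\<lambda>\<theta>. h (circlepath 0 (1 / r) \<theta>)"] by simp
qed

lemma circle_mean_holomorphic:
  assumes "h holomorphic_on ball 0 r'" "0 < r" "r < r'"
  shows "circle_mean r h = h 0"
proof -
  have "h holomorphic_on cball 0 r"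
    using assms by (auto intro: holomorphic_on_subset)
  then have "((\<lambda>u. h u / (u - 0)) has_contour_integral (2 * of_real pi * \<i> * h 0)) (circlepath 0 r)"
    using assms(2) by (intro Cauchy_integral_circlepath_simple) auto
  then have "contour_integral (circlepath 0 r) (\<lambda>u. h u / u) = 2 * of_real pi * \<i> * h 0"
    by (simp add: contour_integral_unique)
  then have "circle_mean r (\<lambda>w. h w / w * w) = h 0"
    by (simp add: contour_integral_eq_circle_mean)
  moreover have "circle_mean r (\<lambda>w. h w / w * w) = circle_mean r h"
    unfolding circle_mean_def using norm_circlepath_0[OF assms(2)] assms(2)
    by (intro Henstock_Kurzweil_Integration.integral_cong) (metis nonzero_eq_divide_eq norm_zero less_irrefl)
  ultimately show ?thesis by simp
qed

lemma circle_mean_inverse_power: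
  assumes "0 < r" "0 < n"
  shows "circle_mean r (\<lambda>w. inverse w ^ n) = 0"
  using circle_mean_inverse[of r "\<lambda>w. w ^ n"] circle_mean_holomorphic[of "\<lambda>w. w ^ n" "1 / r + 1" "1 / r"] assms
  by (simp add: holomorphic_on_power)

lemma circle_mean_mult_left: "circle_mean r (\<lambda>w. c * h w) = c * circle_mean r h"
  by (simp add: circle_mean_def)

lemma circle_mean_cong:
  "0 < r \<Longrightarrow> (\<And>w. cmod w = r \<Longrightarrow> g w = h w) \<Longrightarrow> circle_mean r g = circle_mean r h"
  unfolding circle_mean_def by (intro Henstock_Kurzweil_Integration.integral_cong) (simp add: norm_circlepath_0)

text \<open>The result is kept as a function of the whole assignment, so that the operators of
  different coordinates compose and can be permuted.\<close>

definition coord_mean :: "real \<Rightarrow> nat \<Rightarrow> ((nat \<Rightarrow> complex) \<Rightarrow> complex) \<Rightarrow> (nat \<Rightarrow> complex) \<Rightarrow> complex" where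
  "coord_mean r i G u = circle_mean r (\<lambda>w. G (u(i := w)))"

definition torus_mean :: "real \<Rightarrow> nat list \<Rightarrow> ((nat \<Rightarrow> complex) \<Rightarrow> complex) \<Rightarrow> (nat \<Rightarrow> complex) \<Rightarrow> complex" where
  "torus_mean r = foldr (coord_mean r)"

lemma torus_mean_Nil [simp]: "torus_mean r [] G = G"
  and torus_mean_Cons [simp]: "torus_mean r (i # is) G = coord_mean r i (torus_mean r is G)"
  by (simp_all add: torus_mean_def)

lemma torus_mean_mult_left: "torus_mean r is (\<lambda>u. c * G u) = (\<lambda>u. c * torus_mean r is G u)"
  by (induction "is") (auto simp: coord_mean_def circle_mean_mult_left)

lemma torus_mean_upd:
  "i \<notin> set is \<Longrightarrow> torus_mean r is G (v(i := w)) = torus_mean r is (\<lambda>u. G (u(i := w))) v"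
proof (induction "is" arbitrary: v)
  case (Cons j js)
  then have "i \<noteq> j" "i \<notin> set js" by auto
  then have "torus_mean r js G ((v(i := w))(j := w')) = torus_mean r js (\<lambda>u. G (u(i := w))) (v(j := w'))" for w'
    by (metis Cons.IH fun_upd_twist)
  then show ?case by (simp only: torus_mean_Cons coord_mean_def)
qed simp

text \<open>The substitution z = 1/u turns large circles into small ones. The product of the
  \<open>inverse (u i)\<close> is the factor z that each dz brings when a contour integral becomes a
  mean.\<close>

lemma multi_circle_integral_eq_torus_mean:
  assumes "0 < r" "distinct is"
  shows "multi_circle_integral (1 / r) is F
    = torus_mean r is (\<lambda>u. F (\<lambda>i. inverse (u i)) * (\<Prod>i\<in>set is. inverse (u i))) (\<lambda>_. 0)"
  using assms(2)
proof (induction "is" arbitrary: F)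
  case (Cons i js)
  have "multi_circle_integral (1 / r) (i # js) F
      = circle_mean (1 / r) (\<lambda>w. w * multi_circle_integral (1 / r) js (\<lambda>z. F (z(i := w))))"
    by (simp add: contour_integral_eq_circle_mean mult.commute)
  also have "\<dots> = circle_mean r (\<lambda>w. inverse w * multi_circle_integral (1 / r) js (\<lambda>z. F (z(i := inverse w))))"
    by (rule circle_mean_inverse[OF assms(1), symmetric])
  also have "\<dots> = circle_mean r (\<lambda>w. torus_mean r js
      (\<lambda>u. F (\<lambda>k. inverse (u k)) * (\<Prod>k\<in>set (i # js). inverse (u k))) ((\<lambda>_. 0)(i := w)))"
  proof (intro arg_cong[where f = "circle_mean r"] ext)
    fix w
    have ij: "i \<notin> set js" using Cons.prems by simp
    have upd: "(\<lambda>k. inverse (if k = i then w else u k :: complex)) = (\<lambda>k. inverse (u k))(i := inverse w)" for u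
      by auto
    have pr: "(\<Prod>k\<in>set js. inverse (if k = i then w else u k :: complex)) = (\<Prod>k\<in>set js. inverse (u k))" for u
      using ij by (intro prod.cong) auto
    show "inverse w * multi_circle_integral (1 / r) js (\<lambda>z. F (z(i := inverse w))) =
      torus_mean r js (\<lambda>u. F (\<lambda>k. inverse (u k)) * (\<Prod>k\<in>set (i # js). inverse (u k))) ((\<lambda>_. 0)(i := w))"
      using Cons.prems unfolding torus_mean_upd[OF ij]
      by (simp add: Cons.IH upd pr mult.left_commute[of _ "inverse w"] torus_mean_mult_left)
  qed
  finally show ?case by (simp add: coord_mean_def)
qed simp

section \<open>Continuity, exchange and relabelling of means on the torus\<close>

definition torus :: "real \<Rightarrow> (nat \<Rightarrow> complex) set" where
  "torus r = {u. \<forall>i. cmod (u i) = r}"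

lemma torus_upd: "u \<in> torus r \<Longrightarrow> cmod w = r \<Longrightarrow> u(i := w) \<in> torus r"
  by (simp add: torus_def)

text \<open>Tychonoff's theorem. All coordinates are kept on the circle, also those that are not
  integrated, so that one compact set serves every index set.\<close>

lemma compact_torus: "compact (torus r)"
proof -
  have "torus r = PiE UNIV (\<lambda>_. sphere 0 r)"
    by (auto simp: torus_def)
  moreover have "compactin (product_topology (\<lambda>_. euclidean) UNIV) (PiE UNIV (\<lambda>_. sphere 0 r) :: (nat \<Rightarrow> complex) set)"
    by (simp add: compactin_PiE)
  ultimately show ?thesis
    by (simp add: euclidean_product_topology)
qed

lemma continuous_on_circlepath_upd:
  assumes "0 < r"
  shows "continuous_on (torus r \<times> {0..1}) (\<lambda>(u, \<theta>). u(i := circlepath 0 r \<theta>))"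
proof (rule continuous_on_coordinatewise_then_product)
  fix j
  have "continuous_on (torus r \<times> {0..1}) (\<lambda>x. (fst x) j :: complex)"
    by (rule continuous_on_product_then_coordinatewise[OF continuous_on_fst[OF continuous_on_id]])
  moreover have "continuous_on (torus r \<times> {0..1}) (\<lambda>x. circlepath 0 r (snd x))"
    unfolding circlepath_0 by (intro continuous_intros)
  ultimately show "continuous_on (torus r \<times> {0..1}) (\<lambda>x. (case x of (u, \<theta>) \<Rightarrow> u(i := circlepath 0 r \<theta>)) j)"
    by (cases "i = j") (simp_all add: case_prod_beta')
qed

lemma continuous_on_torus_upd:
  assumes "0 < r" "continuous_on (torus r) G"
  shows "continuous_on (torus r \<times> {0..1}) (\<lambda>(u, \<theta>). G (u(i := circlepath 0 r \<theta>)))"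
proof -
  have "continuous_on (torus r \<times> {0..1}) (\<lambda>x. G ((\<lambda>(u, \<theta>). u(i := circlepath 0 r \<theta>)) x))"
    using assms(1)
    by (intro continuous_on_compose2[OF assms(2) continuous_on_circlepath_upd])
      (auto intro!: torus_upd simp: norm_circlepath_0)
  then show ?thesis by (simp add: case_prod_beta')
qed

lemma continuous_on_coord_mean:
  assumes "0 < r" "continuous_on (torus r) G"
  shows "continuous_on (torus r) (coord_mean r i G)"
  using integral_continuous_on_param[of "torus r" 0 "1::real" "\<lambda>u \<theta>. G (u(i := circlepath 0 r \<theta>))"]
    continuous_on_torus_upd[OF assms]
  unfolding coord_mean_def [abs_def] circle_mean_def by simp

lemma continuous_on_torus_mean:
  "0 < r \<Longrightarrow> continuous_on (torus r) G \<Longrightarrow> continuous_on (torus r) (torus_mean r is G)"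
  by (induction "is") (auto intro: continuous_on_coord_mean)

lemma coord_mean_commute:
  assumes "0 < r" "continuous_on (torus r) G" "u \<in> torus r"
  shows "coord_mean r i (coord_mean r j G) u = coord_mean r j (coord_mean r i G) u"
proof (cases "i = j")
  case False
  have "continuous_on (cbox (0, 0) (1, 1))
      (\<lambda>p :: real \<times> real. G (u(i := circlepath 0 r (fst p), j := circlepath 0 r (snd p))))"
  proof (intro continuous_on_compose2[OF assms(2)] continuous_on_coordinatewise_then_product)
    fix k
    have "continuous_on (cbox (0, 0) (1, 1)) (\<lambda>x :: real \<times> real. circlepath 0 r (fst x))"
      "continuous_on (cbox (0, 0) (1, 1)) (\<lambda>x :: real \<times> real. circlepath 0 r (snd x))"
      unfolding circlepath_0 by (intro continuous_intros)+
    then show "continuous_on (cbox (0, 0) (1, 1))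
        (\<lambda>p :: real \<times> real. (u(i := circlepath 0 r (fst p), j := circlepath 0 r (snd p))) k)"
      by (cases "k = j"; cases "k = i") simp_all
  qed (use assms(1,3) in \<open>auto simp: torus_def norm_circlepath_0\<close>)
  then have "continuous_on (cbox (0, 0) (1, 1))
      (\<lambda>(x, y). G (u(i := circlepath 0 r x, j := circlepath 0 r y)))"
    by (simp add: case_prod_beta')
  from integral_swap_continuous[OF this] False show ?thesis
    unfolding coord_mean_def circle_mean_def by (simp add: fun_upd_twist)
qed simp

lemma coord_mean_cong:
  assumes "0 < r" "\<And>v. v \<in> torus r \<Longrightarrow> G v = H v" "u \<in> torus r"
  shows "coord_mean r i G u = coord_mean r i H u"
  unfolding coord_mean_def
  by (intro circle_mean_cong) (use assms torus_upd in auto)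

lemma torus_mean_cong:
  assumes "0 < r" "\<And>v. v \<in> torus r \<Longrightarrow> G v = H v" "u \<in> torus r"
  shows "torus_mean r is G u = torus_mean r is H u"
  using assms(3) by (induction "is" arbitrary: u) (auto intro: coord_mean_cong assms)

lemma coord_mean_torus_mean_commute:
  assumes "0 < r" "continuous_on (torus r) G" "u \<in> torus r"
  shows "coord_mean r i (torus_mean r js G) u = torus_mean r js (coord_mean r i G) u"
  using assms(3)
proof (induction js arbitrary: u)
  case (Cons j js)
  have "coord_mean r i (torus_mean r (j # js) G) u = coord_mean r j (coord_mean r i (torus_mean r js G)) u"
    using coord_mean_commute[OF assms(1) continuous_on_torus_mean[OF assms(1,2)] Cons.prems] by simp
  also have "\<dots> = coord_mean r j (torus_mean r js (coord_mean r i G)) u"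
    by (rule coord_mean_cong[OF assms(1) Cons.IH Cons.prems])
  finally show ?case by simp
qed simp

lemma torus_mean_remove1:
  assumes "0 < r" "continuous_on (torus r) G" "u \<in> torus r" "i \<in> set xs"
  shows "torus_mean r xs G u = torus_mean r (i # remove1 i xs) G u"
  using assms(3,4)
proof (induction xs arbitrary: u)
  case (Cons x xs)
  show ?case
  proof (cases "x = i")
    case False
    have "torus_mean r (x # xs) G u = coord_mean r x (coord_mean r i (torus_mean r (remove1 i xs) G)) u"
      using Cons False by (auto intro!: coord_mean_cong assms)
    also have "\<dots> = coord_mean r i (coord_mean r x (torus_mean r (remove1 i xs) G)) u"
      by (intro coord_mean_commute continuous_on_torus_mean assms Cons.prems)
    finally show ?thesis using False by simp
  qed simp
qed simp

lemma torus_mean_mset_eq: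
  assumes "0 < r" "continuous_on (torus r) G" "u \<in> torus r" "mset xs = mset ys"
  shows "torus_mean r xs G u = torus_mean r ys G u"
  using assms(3,4)
proof (induction xs arbitrary: u ys)
  case (Cons x xs)
  then have "x \<in> set ys" "mset xs = mset (remove1 x ys)"
    by (auto simp: set_mset_mset[symmetric] simp flip: Cons.prems(2) simp del: set_mset_mset)
  then have "torus_mean r ys G u = torus_mean r (x # remove1 x ys) G u"
    by (intro torus_mean_remove1 assms Cons.prems)
  also have "\<dots> = torus_mean r (x # xs) G u"
    using Cons.IH[OF _ \<open>mset xs = _\<close>] by (auto intro!: coord_mean_cong assms Cons.prems)
  finally show ?case by simp
qed simp

text \<open>The order of integration is free, so coordinate \<open>i\<close> can be integrated
  innermost. Through this lemma a mean over many variables is shown to vanish by looking at a single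
  one.\<close>

lemma torus_mean_eq_0_of_coord:
  assumes "0 < r" "continuous_on (torus r) G" "u \<in> torus r" "i \<in> set xs"
    and "\<And>v. v \<in> torus r \<Longrightarrow> coord_mean r i G v = 0"
  shows "torus_mean r xs G u = 0"
proof -
  have "torus_mean r xs G u = coord_mean r i (torus_mean r (remove1 i xs) G) u"
    using torus_mean_remove1[OF assms(1-4)] by simp
  also have "\<dots> = torus_mean r (remove1 i xs) (coord_mean r i G) u"
    by (rule coord_mean_torus_mean_commute[OF assms(1-3)])
  \<comment> \<open>The zero function is written as a product so that
    \<open>torus_mean_mult_left\<close> can pull out a factor 0.\<close>
  also have "\<dots> = torus_mean r (remove1 i xs) (\<lambda>_. 0 * 0) u"
    using assms(5) by (intro torus_mean_cong[OF assms(1) _ assms(3)]) simp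
  also have "\<dots> = 0" unfolding torus_mean_mult_left by simp
  finally show ?thesis .
qed

lemma torus_mean_transpose:
  assumes "bij \<pi>"
  shows "torus_mean r xs (\<lambda>u. G (u \<circ> \<pi>)) u = torus_mean r (map (inv \<pi>) xs) G (u \<circ> \<pi>)"
proof (induction xs arbitrary: u)
  case (Cons x xs)
  have "(u(x := w)) \<circ> \<pi> = (u \<circ> \<pi>)(inv \<pi> x := w)" for w
    using assms by (auto simp: fun_eq_iff bij_is_inj bij_is_surj surj_f_inv_f)
  then show ?case by (simp only: list.map torus_mean_Cons coord_mean_def Cons)
qed simp

text \<open>Integrated coordinates of the base point are overwritten, and once overwritten they are
  common to both assignments; hence \<open>A\<close> grows in the induction. The lemma moves the
  base point from the zero assignment, which is not on the torus, to a point that is.\<close>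

lemma torus_mean_base_cong:
  assumes "\<And>u v. (\<And>i. i \<in> A \<union> set xs \<Longrightarrow> u i = v i) \<Longrightarrow> G u = G v"
    and "\<And>i. i \<in> A \<Longrightarrow> u i = v i"
  shows "torus_mean r xs G u = torus_mean r xs G v"
  using assms
proof (induction xs arbitrary: A u v)
  case Nil
  have "G u = G v" by (rule Nil.prems(1)) (rule Nil.prems(2), simp)
  then show ?case by simp
next
  case (Cons x xs)
  have "torus_mean r xs G (u(x := w)) = torus_mean r xs G (v(x := w))" for w
  proof (rule Cons.IH[of "insert x A"])
    fix u v :: "nat \<Rightarrow> complex" assume "\<And>i. i \<in> insert x A \<union> set xs \<Longrightarrow> u i = v i"
    then show "G u = G v" by (intro Cons.prems(1)) simp
  qed (use Cons.prems(2) in auto)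
  then show ?case by (simp add: coord_mean_def)
qed

section \<open>Linearity, bounds and termwise integration\<close>

lemma integrable_circle:
  fixes G :: "(nat \<Rightarrow> complex) \<Rightarrow> complex"
  assumes "0 < r" "continuous_on (torus r) G" "u \<in> torus r"
  shows "(\<lambda>\<theta>. G (u(i := circlepath 0 r \<theta>))) integrable_on {0..1}"
proof (rule integrable_continuous_interval)
  have "continuous_on {0..1} (\<lambda>\<theta>. (u, \<theta>))" by (intro continuous_intros)
  from continuous_on_compose2[OF continuous_on_torus_upd[OF assms(1,2)] this] assms(3)
  show "continuous_on {0..1} (\<lambda>\<theta>. G (u(i := circlepath 0 r \<theta>)))" by auto
qed

lemma torus_mean_add:
  assumes "0 < r" "continuous_on (torus r) G" "continuous_on (torus r) H" "u \<in> torus r"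
  shows "torus_mean r xs (\<lambda>v. G v + H v) u = torus_mean r xs G u + torus_mean r xs H u"
  using assms(4)
proof (induction xs arbitrary: u)
  case (Cons x xs)
  have "torus_mean r (x # xs) (\<lambda>v. G v + H v) u
      = coord_mean r x (\<lambda>v. torus_mean r xs G v + torus_mean r xs H v) u"
    by (auto intro!: coord_mean_cong assms Cons)
  also have "\<dots> = torus_mean r (x # xs) G u + torus_mean r (x # xs) H u"
    using integrable_circle[OF assms(1) continuous_on_torus_mean[OF assms(1,2)] Cons.prems]
      integrable_circle[OF assms(1) continuous_on_torus_mean[OF assms(1,3)] Cons.prems]
    by (simp add: coord_mean_def circle_mean_def Henstock_Kurzweil_Integration.integral_add)
  finally show ?case .
qed simp

lemma torus_mean_sum:
  assumes "0 < r" "\<And>k. k \<in> A \<Longrightarrow> continuous_on (torus r) (G k)" "u \<in> torus r"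
  shows "torus_mean r xs (\<lambda>v. \<Sum>k\<in>A. G k v) u = (\<Sum>k\<in>A. torus_mean r xs (G k) u)"
  using assms(2)
proof (induction A rule: infinite_finite_induct)
  case (insert k A)
  then show ?case
    using torus_mean_add[OF assms(1), of "G k" "\<lambda>v. \<Sum>k\<in>A. G k v" u xs] assms(3)
    by (simp add: continuous_on_sum)
qed (use torus_mean_mult_left[of r xs 0] in simp_all)

lemma torus_mean_diff:
  assumes "0 < r" "continuous_on (torus r) G" "continuous_on (torus r) H" "u \<in> torus r"
  shows "torus_mean r xs (\<lambda>v. G v - H v) u = torus_mean r xs G u - torus_mean r xs H u"
  using torus_mean_add[of r G "\<lambda>v. (-1) * H v" u xs] assms
  by (simp add: continuous_on_minus torus_mean_mult_left[of r xs "-1", simplified])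

lemma norm_torus_mean_le:
  assumes "0 < r" "continuous_on (torus r) G" "u \<in> torus r" "\<And>v. v \<in> torus r \<Longrightarrow> cmod (G v) \<le> B"
  shows "cmod (torus_mean r xs G u) \<le> B"
  using assms(3)
proof (induction xs arbitrary: u)
  case (Cons x xs)
  have "cmod (integral {0..1} (\<lambda>\<theta>. torus_mean r xs G (u(x := circlepath 0 r \<theta>)))) \<le> integral {0..1} (\<lambda>_::real. B)"
    by (intro integral_norm_bound_integral integrable_circle continuous_on_torus_mean assms Cons.IH Cons.prems)
      (use torus_upd[OF Cons.prems norm_circlepath_0[OF assms(1)]] in \<open>auto simp del: fun_upd_apply simp add: Cons.IH assms(1)\<close>)
  then show ?case by (simp add: coord_mean_def circle_mean_def)
qed (use assms(4) in auto)

text \<open>Weierstrass test: the tails of \<open>B\<close> bound the distance to the partial sums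
  uniformly on the torus, and a mean preserves a uniform bound.\<close>

lemma torus_mean_sums:
  assumes r: "0 < r" and g: "\<And>n. continuous_on (torus r) (g n)" and G: "continuous_on (torus r) G"
    and sums: "\<And>v. v \<in> torus r \<Longrightarrow> (\<lambda>n. g n v) sums G v"
    and bound: "\<And>n v. v \<in> torus r \<Longrightarrow> cmod (g n v) \<le> B n" and B: "summable B"
    and u: "u \<in> torus r"
  shows "(\<lambda>n. torus_mean r xs (g n) u) sums torus_mean r xs G u"
proof -
  have tail: "cmod (G v - (\<Sum>k<n. g k v)) \<le> (\<Sum>k. B (k + n))" if v: "v \<in> torus r" for v n
  proof -
    have "G v - (\<Sum>k<n. g k v) = (\<Sum>k. g (k + n) v)"
      using sums_split_initial_segment[OF sums[OF v], of n] by (simp add: sums_iff)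
    also have "cmod \<dots> \<le> (\<Sum>k. B (k + n))"
      using bound[OF v] by (intro norm_suminf_le) (auto simp: B summable_iff_shift)
    finally show ?thesis .
  qed
  have "cmod (torus_mean r xs G u - (\<Sum>k<n. torus_mean r xs (g k) u)) \<le> (\<Sum>k. B (k + n))" for n
  proof -
    have "torus_mean r xs G u - (\<Sum>k<n. torus_mean r xs (g k) u) = torus_mean r xs (\<lambda>v. G v - (\<Sum>k<n. g k v)) u"
      using r g G u by (simp add: torus_mean_diff torus_mean_sum continuous_on_sum)
    also have "cmod \<dots> \<le> (\<Sum>k. B (k + n))"
      by (rule norm_torus_mean_le[OF r _ u tail]) (use g G in \<open>auto intro!: continuous_on_diff continuous_on_sum\<close>)
    finally show ?thesis .
  qed
  then have "(\<lambda>n. torus_mean r xs G u - (\<Sum>k<n. torus_mean r xs (g k) u)) \<longlonglongrightarrow> 0"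
    by (intro Lim_null_comparison[OF always_eventually suminf_exist_split2[OF B]]) blast
  then have "(\<lambda>n. torus_mean r xs G u - (torus_mean r xs G u - (\<Sum>k<n. torus_mean r xs (g k) u))) \<longlonglongrightarrow> torus_mean r xs G u - 0"
    by (intro tendsto_diff tendsto_const)
  then show ?thesis by (simp add: sums_def)
qed

section \<open>The kernel and its power series coefficients\<close>

definition pairs :: "nat set \<Rightarrow> (nat \<times> nat) set" where
  "pairs S = {(i, j). i \<in> S \<and> j \<in> S \<and> i < j}"

lemma finite_pairs [simp]: "finite S \<Longrightarrow> finite (pairs S)"
  by (rule finite_subset[of _ "S \<times> S"]) (auto simp: pairs_def)

text \<open>Here \<open>r\<close> is the reciprocal of the radius of the contours. The bound 1/3
  comes from \<open>D_nonzero\<close>, where 2/3 + 1/9 < 1 excludes a zero of the denominator for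
  every \<open>b\<close> below 1.\<close>

locale hl_contours =
  fixes b r :: real
  assumes b_pos: "0 < b" and b_less_1: "b < 1" and r_pos: "0 < r" and r_less: "r < 1 / 3"
begin

abbreviation \<beta> :: complex where "\<beta> \<equiv> of_real b"

definition D :: "complex \<Rightarrow> complex \<Rightarrow> complex" where
  "D x v = 1 - (1 + \<beta>) * v + \<beta> * x * v"

definition K :: "complex \<Rightarrow> complex \<Rightarrow> complex" where
  "K x v = \<beta> * (x - v) / D x v"

lemma D_nonzero:
  assumes "cmod x < 1 / 3" "cmod v < 1 / 3"
  shows "D x v \<noteq> 0"
proof
  assume "D x v = 0"
  then have "1 = (1 + \<beta>) * v - \<beta> * x * v" by (simp add: D_def algebra_simps)
  then have "1 = cmod ((1 + \<beta>) * v - \<beta> * x * v)" by simp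
  also have "\<dots> \<le> cmod ((1 + \<beta>) * v) + cmod (\<beta> * x * v)" by (rule norm_triangle_ineq4)
  also have "\<dots> \<le> 2 * (1 / 3) + 1 * (1 / 3) * cmod v"
  proof (intro add_mono)
    have "cmod (1 + \<beta>) \<le> 2" using b_pos b_less_1 norm_triangle_ineq[of 1 \<beta>] by simp
    then show "cmod ((1 + \<beta>) * v) \<le> 2 * (1 / 3)"
      unfolding norm_mult using assms by (intro mult_mono) auto
    show "cmod (\<beta> * x * v) \<le> 1 * (1 / 3) * cmod v"
      unfolding norm_mult using assms b_pos b_less_1 by (intro mult_right_mono mult_mono) auto
  qed
  also have "\<dots> < 1" using assms by simp
  finally show False by simp
qed

definition polydisc :: "(nat \<Rightarrow> complex) set" where
  "polydisc = {u. \<forall>i. cmod (u i) < 1 / 3}"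

lemma torus_polydisc: "u \<in> torus r \<Longrightarrow> u \<in> polydisc"
  using r_less by (auto simp: torus_def polydisc_def)

lemma polydisc_upd: "u \<in> torus r \<Longrightarrow> w \<in> ball 0 (1 / 3) \<Longrightarrow> u(i := w) \<in> polydisc"
  using r_less by (auto simp: torus_def polydisc_def)

lemma torus_nonzero: "u \<in> torus r \<Longrightarrow> u i \<noteq> 0"
  using r_pos by (auto simp: torus_def)

lemma polydisc_D: "u \<in> polydisc \<Longrightarrow> D (u i) (u j) \<noteq> 0"
  by (intro D_nonzero) (auto simp: polydisc_def)

lemma polydisc_1: "u \<in> polydisc \<Longrightarrow> 1 - u i \<noteq> 0"
  by (auto simp: polydisc_def dest!: spec[of _ i])

lemma polydisc_1': "u \<in> polydisc \<Longrightarrow> 1 - \<beta> * u i \<noteq> 0"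
proof
  assume "u \<in> polydisc" "1 - \<beta> * u i = 0"
  then have "cmod (\<beta> * u i) = 1" "cmod (u i) < 1 / 3" by (auto simp: polydisc_def)
  moreover have "cmod (\<beta> * u i) \<le> 1 * cmod (u i)"
    unfolding norm_mult using b_pos b_less_1 by (intro mult_right_mono) auto
  ultimately show False by simp
qed

text \<open>\<open>J\<close> collects the variables in which the function has no pole at 0, so that
  Cauchy's theorem applies to them; in the others negative powers are allowed and only continuity on
  the torus is retained. In particular \<open>nice {}\<close> is continuity.\<close>

definition nice :: "nat set \<Rightarrow> ((nat \<Rightarrow> complex) \<Rightarrow> complex) \<Rightarrow> bool" where
  "nice J \<Phi> \<longleftrightarrow> continuous_on (torus r) \<Phi> \<and>
    (\<forall>l\<in>J. \<forall>u\<in>torus r. (\<lambda>w. \<Phi> (u(l := w))) holomorphic_on ball 0 (1 / 3))"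

named_theorems nice_intros

lemma nice_continuous: "nice J \<Phi> \<Longrightarrow> continuous_on (torus r) \<Phi>"
  by (simp add: nice_def)

lemma nice_mono: "nice J \<Phi> \<Longrightarrow> J' \<subseteq> J \<Longrightarrow> nice J' \<Phi>"
  by (auto simp: nice_def)

lemma nice_const [nice_intros]: "nice J (\<lambda>_. c)"
  by (auto simp: nice_def intro!: continuous_intros)

lemma continuous_on_torus_coord: "continuous_on (torus r) (\<lambda>u. u i :: complex)"
  by (rule continuous_on_product_then_coordinatewise[OF continuous_on_id])

lemma nice_coord [nice_intros]: "nice J (\<lambda>u. u i)"
proof -
  have "(\<lambda>w. (u(l := w)) i) holomorphic_on ball 0 (1 / 3)" for l u
    by (cases "l = i") (auto intro: holomorphic_intros)
  then show ?thesis
    unfolding nice_def using continuous_on_torus_coord by blast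
qed

lemma nice_add [nice_intros]: "nice J f \<Longrightarrow> nice J g \<Longrightarrow> nice J (\<lambda>u. f u + g u)"
  and nice_diff [nice_intros]: "nice J f \<Longrightarrow> nice J g \<Longrightarrow> nice J (\<lambda>u. f u - g u)"
  and nice_mult [nice_intros]: "nice J f \<Longrightarrow> nice J g \<Longrightarrow> nice J (\<lambda>u. f u * g u)"
  by (auto simp: nice_def intro!: continuous_intros holomorphic_intros)

lemma nice_power [nice_intros]: "nice J f \<Longrightarrow> nice J (\<lambda>u. f u ^ n)"
  by (auto simp: nice_def intro!: continuous_intros holomorphic_intros)

lemma nice_prod [nice_intros]: "(\<And>k. k \<in> A \<Longrightarrow> nice J (f k)) \<Longrightarrow> nice J (\<lambda>u. \<Prod>k\<in>A. f k u)"
  by (auto simp: nice_def intro!: continuous_intros holomorphic_intros)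

lemma nice_sum [nice_intros]: "(\<And>k. k \<in> A \<Longrightarrow> nice J (f k)) \<Longrightarrow> nice J (\<lambda>u. \<Sum>k\<in>A. f k u)"
  by (auto simp: nice_def intro!: continuous_intros holomorphic_intros)

lemma nice_exp [nice_intros]: "nice J f \<Longrightarrow> nice J (\<lambda>u. exp (f u))"
  by (auto simp: nice_def intro!: continuous_intros holomorphic_intros)

lemma nice_divide [nice_intros]:
  "nice J f \<Longrightarrow> nice J g \<Longrightarrow> (\<And>u. u \<in> polydisc \<Longrightarrow> g u \<noteq> 0) \<Longrightarrow> nice J (\<lambda>u. f u / g u)"
  unfolding nice_def
  by (intro conjI ballI continuous_on_divide holomorphic_on_divide)
    (use torus_polydisc polydisc_upd in blast)+

lemma nice_powi [nice_intros]:
  assumes "i \<notin> J"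
  shows "nice J (\<lambda>u. u i powi n)"
proof -
  have "(\<lambda>w. (u(l := w)) i powi n) holomorphic_on ball 0 (1 / 3)" if "l \<in> J" for l u
    using that assms by (cases "l = i") auto
  moreover have "continuous_on (torus r) (\<lambda>u. u i powi n)"
    using torus_nonzero by (intro continuous_on_power_int continuous_on_torus_coord) auto
  ultimately show ?thesis unfolding nice_def by blast
qed

lemma nice_inverse_power [nice_intros]:
  assumes "i \<notin> J"
  shows "nice J (\<lambda>u. inverse (u i) ^ n)"
  using nice_powi[OF assms, of "- int n"] by (simp add: power_int_minus power_inverse)

lemma nice_K [nice_intros]: "nice J (\<lambda>u. K (u i) (u j))"
  unfolding K_def D_def by (intro nice_intros) (use polydisc_D in \<open>auto simp: D_def\<close>)

lemma nice_D [nice_intros]: "nice J (\<lambda>u. D (u i) (u j))"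
  unfolding D_def by (intro nice_intros)

section \<open>Coefficient extraction by means over small circles\<close>

lemma coord_mean_pos_power:
  assumes "nice {i} \<Phi>" "0 < n" "v \<in> torus r"
  shows "coord_mean r i (\<lambda>u. u i ^ n * \<Phi> u) v = 0"
proof -
  have "(\<lambda>w. w ^ n * \<Phi> (v(i := w))) holomorphic_on ball 0 (1 / 3)"
    using assms(1,3) by (auto simp: nice_def intro!: holomorphic_intros)
  then show ?thesis
    using circle_mean_holomorphic[of "\<lambda>w. w ^ n * \<Phi> (v(i := w))" "1 / 3" r] r_pos r_less assms(2)
    by (simp add: coord_mean_def)
qed

lemma coord_mean_neg_power:
  assumes "\<And>w. \<Phi> (v(i := w)) = \<Phi> v" "0 < n"
  shows "coord_mean r i (\<lambda>u. inverse (u i) ^ n * \<Phi> u) v = 0"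
  using circle_mean_mult_left[of r "\<Phi> v" "\<lambda>w. inverse w ^ n"] circle_mean_inverse_power[OF r_pos assms(2)]
  by (simp add: coord_mean_def assms(1) mult.commute)

lemma torus_mean_pos_power:
  assumes "nice {i} \<Phi>" "0 < n" "v \<in> torus r" "i \<in> set xs"
  shows "torus_mean r xs (\<lambda>u. u i ^ n * \<Phi> u) v = 0"
proof (rule torus_mean_eq_0_of_coord[OF r_pos _ assms(3,4)])
  show "continuous_on (torus r) (\<lambda>u. u i ^ n * \<Phi> u)"
    by (intro nice_continuous[of "{i}"] nice_intros assms)
qed (rule coord_mean_pos_power[OF assms(1,2)])

lemma torus_mean_neg_power:
  assumes "nice {} \<Phi>" "\<And>u w. \<Phi> (u(i := w)) = \<Phi> u" "0 < n" "v \<in> torus r" "i \<in> set xs"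
  shows "torus_mean r xs (\<lambda>u. inverse (u i) ^ n * \<Phi> u) v = 0"
proof (rule torus_mean_eq_0_of_coord[OF r_pos _ assms(4,5)])
  show "continuous_on (torus r) (\<lambda>u. inverse (u i) ^ n * \<Phi> u)"
    by (intro nice_continuous[of "{}"] nice_intros assms) auto
qed (rule coord_mean_neg_power, rule assms(2), rule assms(3))

text \<open>The mean of w^(-n) / (1 - w) is the coefficient of w^n in the geometric series. The
  induction splits off the pure negative power w^(-n-1), whose mean is 0.\<close>

lemma coord_mean_geometric:
  assumes "\<And>w. \<Phi> (v(i := w)) = \<Phi> v"
  shows "coord_mean r i (\<lambda>u. inverse (u i) ^ n / (1 - u i) * \<Phi> u) v = \<Phi> v"
proof -
  have "circle_mean r (\<lambda>w. inverse w ^ n / (1 - w)) = 1"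
  proof (induction n)
    case 0
    have "(\<lambda>w. 1 / (1 - w)) holomorphic_on ball 0 (1 / 3 :: real)"
      by (intro holomorphic_intros) auto
    then show ?case
      using circle_mean_holomorphic[of "\<lambda>w. 1 / (1 - w)" "1 / 3" r] r_pos r_less by simp
  next
    case (Suc n)
    let ?P = "\<lambda>\<theta>. circlepath 0 r \<theta>"
    have ne: "?P \<theta> \<noteq> 0" "1 - ?P \<theta> \<noteq> 0" for \<theta>
      using norm_circlepath_0[OF r_pos, of \<theta>] r_pos r_less by auto
    have cont: "continuous_on {0..1} ?P"
      unfolding circlepath_0 by (intro continuous_intros)
    have "circle_mean r (\<lambda>w. inverse w ^ Suc n / (1 - w))
        = circle_mean r (\<lambda>w. inverse w ^ Suc n + inverse w ^ n / (1 - w))"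
    proof (rule circle_mean_cong[OF r_pos])
      fix w :: complex assume "cmod w = r"
      then have "w \<noteq> 0" "1 - w \<noteq> 0" using r_pos r_less by auto
      then have "inverse w / (1 - w) = inverse w + 1 / (1 - w)" by (simp add: field_simps)
      then have "inverse w ^ n * (inverse w / (1 - w)) = inverse w ^ n * (inverse w + 1 / (1 - w))" by (rule arg_cong)
      then show "inverse w ^ Suc n / (1 - w) = inverse w ^ Suc n + inverse w ^ n / (1 - w)"
        by (simp add: algebra_simps)
    qed
    also have "\<dots> = circle_mean r (\<lambda>w. inverse w ^ Suc n) + circle_mean r (\<lambda>w. inverse w ^ n / (1 - w))"
      unfolding circle_mean_def using ne cont
      by (intro Henstock_Kurzweil_Integration.integral_add integrable_continuous_interval)
        (auto intro!: continuous_intros)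
    finally show ?case using Suc circle_mean_inverse_power[OF r_pos, of "Suc n"] by simp
  qed
  then show ?thesis
    using circle_mean_mult_left[of r "\<Phi> v" "\<lambda>w. inverse w ^ n / (1 - w)"]
    by (simp add: coord_mean_def assms mult.commute)
qed

text \<open>\<open>D x v\<close> is affine in \<open>x\<close>, namely
  \<open>c + \<beta> * v * x\<close>, so this is a truncated geometric series. After
  \<open>n\<close> terms the remainder has no negative power of \<open>x\<close> left and carries
  the factor \<open>v ^ n\<close>.\<close>

lemma geometric_D:
  assumes "D x v \<noteq> 0" "1 - (1 + \<beta>) * v \<noteq> 0" "x \<noteq> 0"
  defines "c \<equiv> 1 - (1 + \<beta>) * v"
  shows "inverse x ^ n / D x v = (\<Sum>k<n. inverse x ^ (n - k) * ((- \<beta> * v / c) ^ k / c)) + (- \<beta> * v / c) ^ n / D x v"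
proof (induction n)
  case (Suc n)
  have D: "D x v = c + \<beta> * v * x" by (simp add: D_def c_def)
  let ?q = "- \<beta> * v / c"
  have c: "c \<noteq> 0" using assms by simp
  have step: "1 / D x v = 1 / c + ?q * x / D x v"
  proof -
    have "?q * x = 1 - D x v / c" using c by (simp add: D field_simps)
    then show ?thesis using assms(1) c by (simp add: diff_divide_distrib)
  qed
  have "inverse x ^ Suc n / D x v = inverse x * ((\<Sum>k<n. inverse x ^ (n - k) * (?q ^ k / c)) + ?q ^ n / D x v)"
    using Suc by (metis (no_types, lifting) power_Suc times_divide_eq_right)
  also have "\<dots> = (\<Sum>k<n. inverse x ^ (Suc n - k) * (?q ^ k / c)) + inverse x * ?q ^ n * (1 / D x v)"
    by (simp add: distrib_left sum_distrib_left Suc_diff_le mult.assoc)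
  also have "inverse x * ?q ^ n * (1 / D x v) = inverse x * (?q ^ n / c) + ?q ^ Suc n / D x v"
    using assms(3) unfolding step by (simp add: algebra_simps)
  finally show ?case by simp
qed simp

lemma polydisc_c: "u \<in> polydisc \<Longrightarrow> 1 - (1 + \<beta>) * u j \<noteq> 0"
  using D_nonzero[of 0 "u j"] by (auto simp: D_def polydisc_def)

text \<open>Expanding \<open>1 / D\<close> in powers of \<open>u s\<close>, each power of
  \<open>u s\<close> brings the same power of \<open>u j\<close>; extracting the n-th one yields
  enough of \<open>u j\<close> to outweigh the pole of order \<open>m < n\<close>. In
  \<open>F k\<close> only a negative power depends on \<open>u s\<close>; in \<open>H\<close> a
  positive power of \<open>u j\<close> multiplies a function holomorphic in
  \<open>u j\<close>.\<close>

lemma torus_mean_pair_eq_0: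
  assumes "nice {j} \<Phi>" "\<And>u w. \<Phi> (u(s := w)) = \<Phi> u" "s \<noteq> j" "m < n"
    and "v \<in> torus r" "s \<in> set xs" "j \<in> set xs"
  shows "torus_mean r xs (\<lambda>u. inverse (u s) ^ n * (inverse (u j) ^ m / D (u s) (u j)) * \<Phi> u) v = 0"
proof -
  define c where "c u = 1 - (1 + \<beta>) * u j" for u :: "nat \<Rightarrow> complex"
  define F where "F k u = inverse (u s) ^ (n - k) * ((- \<beta> * u j / c u) ^ k / c u * inverse (u j) ^ m * \<Phi> u)" for k u
  define H where "H u = u j ^ (n - m) * ((- \<beta> / c u) ^ n / D (u s) (u j) * \<Phi> u)" for u
  have c: "nice J c" for J unfolding c_def by (intro nice_intros)
  have c0: "u \<in> polydisc \<Longrightarrow> c u \<noteq> 0" for u using polydisc_c by (simp add: c_def)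
  note \<Phi> = nice_mono[OF assms(1), of "{}", simplified]
  have F: "nice {} (F k)" for k unfolding F_def by (intro nice_intros c \<Phi> c0) auto
  have H: "nice {} H" unfolding H_def by (intro nice_intros c \<Phi> c0 polydisc_D)
  have "torus_mean r xs (\<lambda>u. inverse (u s) ^ n * (inverse (u j) ^ m / D (u s) (u j)) * \<Phi> u) v
    = torus_mean r xs (\<lambda>u. (\<Sum>k<n. F k u) + H u) v"
  proof (rule torus_mean_cong[OF r_pos _ assms(5)])
    fix u assume u: "u \<in> torus r"
    have "inverse (u s) ^ n / D (u s) (u j)
      = (\<Sum>k<n. inverse (u s) ^ (n - k) * ((- \<beta> * u j / c u) ^ k / c u)) + (- \<beta> * u j / c u) ^ n / D (u s) (u j)"
      unfolding c_def
      by (rule geometric_D) (use polydisc_D polydisc_c torus_polydisc u torus_nonzero in auto)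
    then have "inverse (u s) ^ n / D (u s) (u j) * (inverse (u j) ^ m * \<Phi> u)
      = (\<Sum>k<n. F k u) + (- \<beta> * u j / c u) ^ n / D (u s) (u j) * (inverse (u j) ^ m * \<Phi> u)"
      by (simp only: distrib_right sum_distrib_right F_def mult.assoc)
    moreover have "(- \<beta> * u j / c u) ^ n / D (u s) (u j) * (inverse (u j) ^ m * \<Phi> u) = H u"
    proof -
      have "(- \<beta> * u j / c u) ^ n = (- \<beta> / c u) ^ n * u j ^ n" by (simp flip: power_mult_distrib)
      moreover have "u j ^ n * inverse (u j) ^ m = u j ^ (n - m)"
        using torus_nonzero[OF u] assms(4) by (simp add: power_diff power_inverse divide_inverse)
      ultimately show ?thesis by (simp add: H_def mult_ac)
    qed
    ultimately show "inverse (u s) ^ n * (inverse (u j) ^ m / D (u s) (u j)) * \<Phi> u = (\<Sum>k<n. F k u) + H u"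
      by (simp add: mult.assoc)
  qed
  also have "\<dots> = (\<Sum>k<n. torus_mean r xs (F k) v) + torus_mean r xs H v"
    using nice_continuous[OF F] nice_continuous[OF H]
    by (simp add: torus_mean_add torus_mean_sum r_pos assms(5) continuous_on_sum)
  also have "(\<Sum>k<n. torus_mean r xs (F k) v) = 0"
  proof (intro sum.neutral ballI)
    fix k assume "k \<in> {..<n}"
    then show "torus_mean r xs (F k) v = 0"
      unfolding F_def using assms
      by (intro torus_mean_neg_power nice_intros c \<Phi> c0) (auto simp: c_def)
  qed
  also have "torus_mean r xs H v = 0"
    unfolding H_def using assms
    by (intro torus_mean_pos_power nice_intros c c0 polydisc_D) auto
  finally show ?thesis by simp
qed


text \<open>Partial fractions in \<open>x\<close>: both denominators are affine in \<open>x\<close>,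
  and the coefficients on the right depend on \<open>v\<close> or \<open>w\<close> alone. The factor
  \<open>1 - x\<close> belongs to the identity because it has to be used up; left in an integrand it
  would lower the negative power of \<open>x\<close> in some terms.\<close>

lemma D_pair_identity:
  assumes "D x v \<noteq> 0" "D x w \<noteq> 0"
  shows "(1 - x) * (v - w) / (D x v * D x w) = (1 - v) / \<beta> / D x v - (1 - w) / \<beta> / D x w"
proof -
  have "(1 - v) * D x w - (1 - w) * D x v = \<beta> * ((1 - x) * (v - w))"
    by (simp add: D_def algebra_simps)
  moreover have "p / \<beta> / y - q / \<beta> / z = (p * z - q * y) / \<beta> / (y * z)" if "y \<noteq> 0" "z \<noteq> 0" for p q y z
    using that b_pos by (simp add: field_simps)
  ultimately show ?thesis using assms b_pos by simp
qed

text \<open>Induction on the size of \<open>J\<close>. One use of \<open>D_pair_identity\<close>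
  trades a denominator, a factor \<open>1 - u s\<close> and a difference \<open>u i - u j\<close>
  for two terms with one index fewer, so \<open>card J - 1\<close> factors lead exactly to a single
  index, where \<open>torus_mean_pair_eq_0\<close> applies. An index that leaves \<open>J\<close>
  takes its negative power into \<open>\<Phi>\<close>, which is why \<open>\<Phi>\<close> is
  holomorphic only in the variables of \<open>J\<close>.\<close>

lemma torus_mean_core_eq_0:
  assumes "finite J" "J \<noteq> {}" "s \<notin> J" "nice J \<Phi>" "\<And>u w. \<Phi> (u(s := w)) = \<Phi> u"
    and "\<And>j. j \<in> J \<Longrightarrow> a j < n" "v \<in> torus r" "insert s J \<subseteq> set xs"
  shows "torus_mean r xs (\<lambda>u. inverse (u s) ^ n * (1 - u s) ^ (card J - 1)
    * (\<Prod>j\<in>J. inverse (u j) ^ a j / D (u s) (u j)) * (\<Prod>(i, j)\<in>pairs J. u i - u j) * \<Phi> u) v = 0"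
  using assms
proof (induction "card J" arbitrary: J \<Phi> rule: less_induct)
  case less
  show ?case
  proof (cases "\<exists>j. J = {j}")
    case True
    then obtain j where J: "J = {j}" by blast
    then have "pairs J = {}" by (auto simp: pairs_def)
    then show ?thesis
      using torus_mean_pair_eq_0[of j \<Phi> s "a j" n v xs] less.prems J by auto
  next
    case False
    with less.prems obtain i j where ij: "i \<in> J" "j \<in> J" "i < j"
      by (metis (no_types, opaque_lifting) all_not_in_conv linorder_neqE_nat singletonI subsetI subset_singletonD insertCI subset_antisym singletonD)
    define e where "e u l = inverse (u l) ^ a l" for u :: "nat \<Rightarrow> complex" and l
    define trm where "trm J \<Phi> u = inverse (u s) ^ n * (1 - u s) ^ (card J - 1)
      * (\<Prod>j\<in>J. e u j / D (u s) (u j)) * (\<Prod>(i, j)\<in>pairs J. u i - u j) * \<Phi> u"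
      for J :: "nat set" and \<Phi> and u :: "nat \<Rightarrow> complex"
    define W where "W A u = (\<Prod>(k, l)\<in>A. u k - u l)" for A and u :: "nat \<Rightarrow> complex"
    \<comment> \<open>The index \<open>l\<close> leaves and \<open>k\<close> is the one of
      \<open>i\<close>, \<open>j\<close> that stays and supplies the partial fraction coefficient.
      The remaining product consists of the differences that involve \<open>l\<close>, apart from
      the pair \<open>(i, j)\<close> that was used up.\<close>
    define \<Psi> where "\<Psi> k l u = (1 - u k) / \<beta> * e u l * W (pairs J - {(i, j)} - pairs (J - {l})) u * \<Phi> u"
      for k l and u :: "nat \<Rightarrow> complex"
    have s: "s \<noteq> i" "s \<noteq> j" using less.prems ij by auto
    have nice_trm: "nice {} (trm J \<Phi>)" if "nice {} \<Phi>" for J \<Phi>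
      unfolding trm_def [abs_def] e_def case_prod_beta' by (intro nice_intros polydisc_D that) auto
    have nice_\<Psi>: "nice (J - {l}) (\<Psi> k l)" for k l
      unfolding \<Psi>_def [abs_def] e_def W_def case_prod_beta'
      by (intro nice_intros nice_mono[OF less.prems(4)]) (use b_pos in auto)
    have upd: "\<Psi> k l (u(s := w)) = \<Psi> k l u" if "l \<noteq> s" "k \<noteq> s" for k l u w
    proof -
      have "W (pairs J - {(i, j)} - pairs (J - {l})) (u(s := w)) = W (pairs J - {(i, j)} - pairs (J - {l})) u"
      proof -
        have [simp]: "l \<in> J \<Longrightarrow> (l = s) = False" for l using less.prems(3) by auto
        show ?thesis unfolding W_def by (intro prod.cong) (auto simp: pairs_def)
      qed
      then show ?thesis using that less.prems(5)[of u w] unfolding \<Psi>_def e_def by simp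
    qed
    have zero: "torus_mean r xs (trm (J - {l}) (\<Psi> k l)) v = 0" if "k \<in> J - {l}" "l \<in> J" for k l
      unfolding trm_def e_def
      by (rule less.hyps[OF card_Diff1_less _ _ _ nice_\<Psi> upd less.prems(6,7)])
        (use that less.prems in auto)
    have split: "trm J \<Phi> u = trm (J - {j}) (\<Psi> i j) u - trm (J - {i}) (\<Psi> j i) u"
      if u: "u \<in> torus r" for u
    proof -
      define E where "E = (\<Prod>l\<in>J - {i} - {j}. e u l / D (u s) (u l))"
      define V where "V = W (pairs J - {(i, j)}) u"
      have fin: "finite J" by fact
      have E1: "(\<Prod>l\<in>J - {j}. e u l / D (u s) (u l)) = e u i / D (u s) (u i) * E"
      proof -
        have "J - {i} - {j} = J - {j} - {i}" by auto
        then show ?thesis unfolding E_def by (simp only:) (rule prod.remove, use ij fin in auto)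
      qed
      have E2: "(\<Prod>l\<in>J - {i}. e u l / D (u s) (u l)) = e u j / D (u s) (u j) * E"
        unfolding E_def by (rule prod.remove) (use ij fin in auto)
      have E3: "(\<Prod>l\<in>J. e u l / D (u s) (u l)) = e u i / D (u s) (u i) * (e u j / D (u s) (u j) * E)"
        unfolding E2[symmetric] by (rule prod.remove) (use ij fin in auto)
      have V1: "W (pairs (J - {l})) u * W (pairs J - {(i, j)} - pairs (J - {l})) u = V" if "l = i \<or> l = j" for l
      proof -
        have sub: "pairs (J - {l}) \<subseteq> pairs J - {(i, j)}" using that by (auto simp: pairs_def)
        show ?thesis
          unfolding V_def W_def using fin by (subst prod.subset_diff[OF sub]) (simp_all add: mult.commute)
      qed
      have V2: "W (pairs J) u = (u i - u j) * V"
      proof -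
        have "(i, j) \<in> pairs J" using ij by (simp add: pairs_def)
        then show ?thesis
          unfolding V_def W_def using fin by (subst prod.remove[of _ "(i, j)"]) simp_all
      qed
      have "card J \<ge> 2" using ij card_mono[OF fin, of "{i, j}"] by auto
      then obtain p where p: "card J = Suc (Suc p)" by (metis add_2_eq_Suc le_Suc_ex)
      have cards: "card (J - {i}) = Suc p" "card (J - {j}) = Suc p" using ij fin p by auto
      have D: "D (u s) (u i) \<noteq> 0" "D (u s) (u j) \<noteq> 0"
        by (intro polydisc_D torus_polydisc u)+
      define c where "c = inverse (u s) ^ n * (1 - u s) ^ p * e u i * e u j * E * \<Phi> u"
      have "trm J \<Phi> u = c * ((1 - u s) * (u i - u j) / (D (u s) (u i) * D (u s) (u j))) * V"
        unfolding trm_def W_def[symmetric] E3 V2 p c_def by (simp add: mult_ac)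
      also have "\<dots> = c * ((1 - u i) / \<beta> / D (u s) (u i)) * V - c * ((1 - u j) / \<beta> / D (u s) (u j)) * V"
        unfolding D_pair_identity[OF D] by (simp add: algebra_simps)
      also have "c * ((1 - u i) / \<beta> / D (u s) (u i)) * V = trm (J - {j}) (\<Psi> i j) u"
        unfolding trm_def W_def[symmetric] E1 cards \<Psi>_def V1[of j, symmetric, simplified] c_def by (simp add: mult_ac)
      also have "c * ((1 - u j) / \<beta> / D (u s) (u j)) * V = trm (J - {i}) (\<Psi> j i) u"
        unfolding trm_def W_def[symmetric] E2 cards \<Psi>_def V1[of i, symmetric, simplified] c_def by (simp add: mult_ac)
      finally show ?thesis .
    qed
    have "torus_mean r xs (trm J \<Phi>) v = torus_mean r xs (\<lambda>u. trm (J - {j}) (\<Psi> i j) u - trm (J - {i}) (\<Psi> j i) u) v"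
      by (rule torus_mean_cong[OF r_pos split less.prems(7)])
    also have "\<dots> = torus_mean r xs (trm (J - {j}) (\<Psi> i j)) v - torus_mean r xs (trm (J - {i}) (\<Psi> j i)) v"
      by (intro torus_mean_diff r_pos less.prems nice_continuous[OF nice_trm] nice_mono[OF nice_\<Psi>]) auto
    also have "\<dots> = 0" using zero ij by simp
    finally show ?thesis unfolding trm_def e_def .
  qed
qed

section \<open>Means of the kernel product at time 0\<close>

lemma K_eq: "D x v \<noteq> 0 \<Longrightarrow> K x v = - \<beta> * (1 - x) * (1 - \<beta> * v) / D x v + \<beta>"
  by (simp add: K_def field_simps) (simp add: D_def algebra_simps)

lemma pairs_insert:
  assumes "\<And>j. j \<in> S \<Longrightarrow> s < j"
  shows "pairs (insert s S) = (\<lambda>j. (s, j)) ` S \<union> pairs S" "(\<lambda>j. (s, j)) ` S \<inter> pairs S = {}"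
  using assms by (auto simp: pairs_def dest: less_not_sym)

lemma prod_pairs_insert:
  assumes "finite S" "\<And>j. j \<in> S \<Longrightarrow> s < j"
  shows "(\<Prod>(i, j)\<in>pairs (insert s S). f i j) = (\<Prod>j\<in>S. f s j) * (\<Prod>(i, j)\<in>pairs S. f i j)"
  using assms pairs_insert[OF assms(2)]
  by (simp add: prod.union_disjoint prod.reindex inj_on_def)

text \<open>The exponents are x - y_i and decrease along the particles. The product of the
  \<open>K (u s) (u j)\<close> for the smallest index \<open>s\<close> is expanded by
  \<open>K_eq\<close> over subsets \<open>J\<close>. A nonempty \<open>J\<close> gives 0 by
  \<open>torus_mean_core_eq_0\<close>, since \<open>a s\<close> exceeds every \<open>a j\<close>;
  the empty one gives a power of \<open>\<beta>\<close> times the mean of a geometric factor, which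
  is 1. The powers 0, 1, 2, ... of the successive steps add up to the binomial coefficient.\<close>

lemma torus_mean_initial:
  assumes "sorted_wrt (<) xs" "\<And>i j. i \<in> set xs \<Longrightarrow> j \<in> set xs \<Longrightarrow> i < j \<Longrightarrow> a j < a i" "v \<in> torus r"
  shows "torus_mean r xs (\<lambda>u. (\<Prod>(i, j)\<in>pairs (set xs). K (u i) (u j)) * (\<Prod>i\<in>set xs. inverse (u i) ^ a i / (1 - u i))) v
    = \<beta> ^ (length xs choose 2)"
  using assms
proof (induction xs arbitrary: v)
  case Nil
  then show ?case by (simp add: pairs_def binomial_eq_0)
next
  case (Cons s xs)
  define S where "S = set xs"
  have fin: "finite S" and sS: "s \<notin> S" and less_s: "\<And>j. j \<in> S \<Longrightarrow> s < j" and cardS: "card S = length xs"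
    using Cons.prems(1) by (auto simp: S_def distinct_card strict_sorted_iff)
  define H where "H u = (\<Prod>(i, j)\<in>pairs S. K (u i) (u j)) * (\<Prod>i\<in>S. inverse (u i) ^ a i / (1 - u i))"
    for u :: "nat \<Rightarrow> complex"
  \<comment> \<open>All factors of \<open>G J\<close> that \<open>torus_mean_core_eq_0\<close> does
    not display. Negative powers occur only at indices outside \<open>J\<close>, and
    \<open>u s\<close> does not occur.\<close>
  define \<Phi> where "\<Phi> J u = (\<Prod>j\<in>J. - \<beta> * (1 - \<beta> * u j)) * \<beta> ^ card (S - J)
      * (\<Prod>(i, j)\<in>pairs S. \<beta> / D (u i) (u j)) * (\<Prod>(i, j)\<in>pairs S - pairs J. u i - u j)
      * (\<Prod>j\<in>S. 1 / (1 - u j)) * (\<Prod>j\<in>S - J. inverse (u j) ^ a j)" for J and u :: "nat \<Rightarrow> complex"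
  define G where "G J u = inverse (u s) ^ a s * (\<Prod>j\<in>J. - \<beta> * (1 - u s) * (1 - \<beta> * u j) / D (u s) (u j))
      * \<beta> ^ card (S - J) / (1 - u s) * H u" for J and u :: "nat \<Rightarrow> complex"
  have nice_H: "nice {} H"
    unfolding H_def [abs_def] case_prod_beta' by (intro nice_intros polydisc_1) auto
  have nice_G: "nice {} (G J)" for J
    unfolding G_def [abs_def] by (intro nice_intros polydisc_1 polydisc_D nice_H) auto
  have upd_H: "H (u(s := w)) = H u" for u w
    unfolding H_def using sS
    by (intro arg_cong2[where f = "(*)"] prod.cong) (auto simp: pairs_def)
  have G_sum: "(\<Prod>(i, j)\<in>pairs (set (s # xs)). K (u i) (u j)) * (\<Prod>i\<in>set (s # xs). inverse (u i) ^ a i / (1 - u i))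
      = (\<Sum>J\<in>Pow S. G J u)" if u: "u \<in> torus r" for u
  proof -
    have "(\<Prod>(i, j)\<in>pairs (insert s S). K (u i) (u j)) = (\<Prod>j\<in>S. K (u s) (u j)) * (\<Prod>(i, j)\<in>pairs S. K (u i) (u j))"
      by (rule prod_pairs_insert[OF fin less_s])
    moreover have "(\<Prod>j\<in>S. K (u s) (u j)) = (\<Prod>j\<in>S. - \<beta> * (1 - u s) * (1 - \<beta> * u j) / D (u s) (u j) + \<beta>)"
      by (intro prod.cong refl K_eq polydisc_D torus_polydisc u)
    moreover have "\<dots> = (\<Sum>J\<in>Pow S. (\<Prod>j\<in>J. - \<beta> * (1 - u s) * (1 - \<beta> * u j) / D (u s) (u j)) * (\<Prod>j\<in>S - J. \<beta>))"
      by (rule prod_add[OF fin])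
    ultimately show ?thesis
      using sS fin by (simp add: S_def[symmetric] G_def H_def sum_distrib_left sum_distrib_right mult_ac)
  qed
  have zero: "torus_mean r (s # xs) (G J) v = 0" if J: "J \<in> Pow S" "J \<noteq> {}" for J
  proof -
    have finJ: "finite J" using J fin by (auto intro: finite_subset)
    have sub: "pairs J \<subseteq> pairs S" using J by (auto simp: pairs_def)
    have nice_\<Phi>: "nice J (\<Phi> J)"
      unfolding \<Phi>_def [abs_def] case_prod_beta' by (intro nice_intros polydisc_1 polydisc_D) auto
    have upd: "\<Phi> J (u(s := w)) = \<Phi> J u" for u w
    proof -
      have [simp]: "j \<in> S \<Longrightarrow> (j = s) = False" "j \<in> J \<Longrightarrow> (j = s) = False" for j using sS J by auto
      show ?thesis
        unfolding \<Phi>_def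
        by (intro arg_cong2[where f = "(*)"] prod.cong) (auto simp: pairs_def)
    qed
    have "torus_mean r (s # xs) (G J) v = torus_mean r (s # xs) (\<lambda>u. inverse (u s) ^ a s * (1 - u s) ^ (card J - 1)
        * (\<Prod>j\<in>J. inverse (u j) ^ a j / D (u s) (u j)) * (\<Prod>(i, j)\<in>pairs J. u i - u j) * \<Phi> J u) v"
    proof (rule torus_mean_cong[OF r_pos _ Cons.prems(3)])
      fix u assume u: "u \<in> torus r"
      have 1: "1 - u s \<noteq> 0" by (intro polydisc_1 torus_polydisc u)
      have "card J \<noteq> 0" using J finJ by simp
      \<comment> \<open>The factor \<open>1 / (1 - u s)\<close> of the particle \<open>s\<close>
        itself cancels one of the \<open>card J\<close> factors \<open>1 - u s\<close>, which leaves
        the exponent required by \<open>torus_mean_core_eq_0\<close>.\<close>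
      then have p: "(1 - u s) ^ card J / (1 - u s) = (1 - u s) ^ (card J - 1)"
        using 1 by (cases "card J") auto
      have a: "(\<Prod>j\<in>J. - \<beta> * (1 - u s) * (1 - \<beta> * u j) / D (u s) (u j))
        = (1 - u s) ^ card J * (\<Prod>j\<in>J. - \<beta> * (1 - \<beta> * u j)) * (\<Prod>j\<in>J. 1 / D (u s) (u j))"
        by (simp add: prod.distrib[symmetric] prod_constant[symmetric] mult_ac del: prod_constant)
      have b: "(\<Prod>(i, j)\<in>pairs S. K (u i) (u j)) = (\<Prod>(i, j)\<in>pairs S. \<beta> / D (u i) (u j))
         * ((\<Prod>(i, j)\<in>pairs S - pairs J. u i - u j) * (\<Prod>(i, j)\<in>pairs J. u i - u j))"
        unfolding prod.subset_diff[OF sub finite_pairs[OF fin], symmetric]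
        by (simp add: prod.distrib[symmetric] K_def case_prod_beta')
      have c: "(\<Prod>i\<in>S. inverse (u i) ^ a i / (1 - u i))
        = (\<Prod>i\<in>S. 1 / (1 - u i)) * ((\<Prod>i\<in>S - J. inverse (u i) ^ a i) * (\<Prod>i\<in>J. inverse (u i) ^ a i))"
        using J unfolding prod.subset_diff[OF _ fin, of J, symmetric, OF PowD[OF J(1)]]
        by (simp add: prod.distrib[symmetric])
      have d: "(\<Prod>j\<in>J. inverse (u j) ^ a j / D (u s) (u j)) = (\<Prod>j\<in>J. inverse (u j) ^ a j) * (\<Prod>j\<in>J. 1 / D (u s) (u j))"
        by (simp add: prod.distrib[symmetric])
      show "G J u = inverse (u s) ^ a s * (1 - u s) ^ (card J - 1)
        * (\<Prod>j\<in>J. inverse (u j) ^ a j / D (u s) (u j)) * (\<Prod>(i, j)\<in>pairs J. u i - u j) * \<Phi> J u"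
        unfolding G_def H_def \<Phi>_def a b c d p[symmetric] by (simp only: divide_inverse mult_ac)
    qed
    also have "\<dots> = 0"
      using Cons.prems(2,3) J less_s finJ sS
      by (intro torus_mean_core_eq_0 nice_\<Phi> upd) (auto simp: S_def)
    finally show ?thesis .
  qed
  have "torus_mean r (s # xs) (\<lambda>u. (\<Prod>(i, j)\<in>pairs (set (s # xs)). K (u i) (u j)) * (\<Prod>i\<in>set (s # xs). inverse (u i) ^ a i / (1 - u i))) v
    = torus_mean r (s # xs) (\<lambda>u. \<Sum>J\<in>Pow S. G J u) v"
    by (rule torus_mean_cong[OF r_pos G_sum Cons.prems(3)])
  also have "\<dots> = (\<Sum>J\<in>Pow S. torus_mean r (s # xs) (G J) v)"
    by (intro torus_mean_sum r_pos Cons.prems nice_continuous[OF nice_G])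
  also have "\<dots> = torus_mean r (s # xs) (G {}) v"
    using zero fin by (subst sum.remove[of _ "{}"]) auto
  also have "\<dots> = torus_mean r xs (coord_mean r s (G {})) v"
    unfolding torus_mean_Cons
    by (intro coord_mean_torus_mean_commute r_pos nice_continuous[OF nice_G] Cons.prems)
  also have "\<dots> = torus_mean r xs (\<lambda>u. \<beta> ^ length xs * H u) v"
  proof (rule torus_mean_cong[OF r_pos _ Cons.prems(3)])
    fix u
    have "G {} = (\<lambda>u. inverse (u s) ^ a s / (1 - u s) * (\<beta> ^ length xs * H u))"
      by (auto simp: G_def cardS)
    then show "coord_mean r s (G {}) u = \<beta> ^ length xs * H u"
      using coord_mean_geometric[of "\<lambda>u. \<beta> ^ length xs * H u" u s "a s"] upd_H by simp
  qed
  also have "\<dots> = \<beta> ^ length xs * \<beta> ^ (length xs choose 2)"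
    using Cons by (simp add: torus_mean_mult_left H_def S_def)
  also have "\<dots> = \<beta> ^ (length (s # xs) choose 2)"
    by (simp add: numeral_2_eq_2 power_add)
  finally show ?case .
qed

text \<open>A particle to the right of x brings a positive power of its variable, and everything
  else is holomorphic in that variable near 0.\<close>

lemma torus_mean_initial_eq_0:
  assumes "i \<in> set xs" "e i > 0" "v \<in> torus r"
  shows "torus_mean r xs (\<lambda>u. (\<Prod>(i, j)\<in>pairs (set xs). K (u i) (u j)) * (\<Prod>i\<in>set xs. u i powi e i / (1 - u i))) v = 0"
proof -
  define \<Phi> where "\<Phi> u = (\<Prod>(i, j)\<in>pairs (set xs). K (u i) (u j)) * (\<Prod>j\<in>set xs. 1 / (1 - u j)) * (\<Prod>j\<in>set xs - {i}. u j powi e j)"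
    for u :: "nat \<Rightarrow> complex"
  have "(\<Prod>i\<in>set xs. u i powi e i / (1 - u i)) = (\<Prod>j\<in>set xs. 1 / (1 - u j)) * (u i ^ nat (e i) * (\<Prod>j\<in>set xs - {i}. u j powi e j))"
    for u :: "nat \<Rightarrow> complex"
  proof -
    have "(\<Prod>i\<in>set xs. u i powi e i / (1 - u i)) = (\<Prod>j\<in>set xs. 1 / (1 - u j)) * (\<Prod>j\<in>set xs. u j powi e j)"
      by (simp add: prod.distrib[symmetric])
    also have "(\<Prod>j\<in>set xs. u j powi e j) = u i powi e i * (\<Prod>j\<in>set xs - {i}. u j powi e j)"
      by (rule prod.remove) (use assms in auto)
    also have "u i powi e i = u i ^ nat (e i)" using assms(2) by (simp add: power_int_def)
    finally show ?thesis .
  qed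
  then have "(\<lambda>u. (\<Prod>(i, j)\<in>pairs (set xs). K (u i) (u j)) * (\<Prod>i\<in>set xs. u i powi e i / (1 - u i)))
    = (\<lambda>u. u i ^ nat (e i) * \<Phi> u)"
    by (simp add: \<Phi>_def mult_ac)
  moreover have "nice {i} \<Phi>"
    unfolding \<Phi>_def [abs_def] case_prod_beta' by (intro nice_intros polydisc_1) auto
  ultimately show ?thesis using torus_mean_pos_power[of i \<Phi> "nat (e i)" v xs] assms by simp
qed

section \<open>The boundary condition\<close>


text \<open>The base point is a constant assignment because every relabelling of the variables fixes
  it.\<close>

definition tmean :: "nat set \<Rightarrow> ((nat \<Rightarrow> complex) \<Rightarrow> complex) \<Rightarrow> complex" where
  "tmean S G = torus_mean r (sorted_list_of_set S) G (\<lambda>_. of_real r)"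

lemma base_torus [simp]: "(\<lambda>_. of_real r) \<in> torus r"
  using r_pos by (simp add: torus_def)

lemma tmean_cong: "(\<And>u. u \<in> torus r \<Longrightarrow> G u = H u) \<Longrightarrow> tmean S G = tmean S H"
  unfolding tmean_def by (intro torus_mean_cong r_pos base_torus) auto

lemma tmean_mult_left: "tmean S (\<lambda>u. c * G u) = c * tmean S G"
  by (simp add: tmean_def torus_mean_mult_left)

lemma tmean_sum:
  "(\<And>k. k \<in> A \<Longrightarrow> nice {} (G k)) \<Longrightarrow> tmean S (\<lambda>u. \<Sum>k\<in>A. G k u) = (\<Sum>k\<in>A. tmean S (G k))"
  unfolding tmean_def by (intro torus_mean_sum r_pos base_torus nice_continuous)

lemma tmean_diff:
  "nice {} G \<Longrightarrow> nice {} H \<Longrightarrow> tmean S (\<lambda>u. G u - H u) = tmean S G - tmean S H"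
  unfolding tmean_def by (intro torus_mean_diff r_pos base_torus nice_continuous)

lemma tmean_transpose:
  assumes "bij \<pi>" "finite S" "nice {} G"
  shows "tmean (inv \<pi> ` S) G = tmean S (\<lambda>u. G (u \<circ> \<pi>))"
proof -
  have inj: "inj (inv \<pi>)" using assms(1) by (simp add: bij_is_surj inj_imp_surj_inv surj_imp_inj_inv)
  have "mset (map (inv \<pi>) (sorted_list_of_set S)) = mset (sorted_list_of_set (inv \<pi> ` S))"
    using inj assms(2) by (subst set_eq_iff_mset_eq_distinct[symmetric]) (auto simp: distinct_map intro: inj_on_subset)
  note eq = torus_mean_mset_eq[OF r_pos nice_continuous[OF assms(3)] base_torus this]
  have "(\<lambda>_. of_real r) \<circ> \<pi> = (\<lambda>_::nat. of_real r :: complex)" by auto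
  then show ?thesis
    unfolding tmean_def torus_mean_transpose[OF assms(1)] by (simp only: eq)
qed

text \<open>The factors of the theorem's integrand, free of y and t, that are invariant under
  permutations of the variables; the kernel product is not.\<close>

definition symm_part :: "int \<Rightarrow> nat set \<Rightarrow> (nat \<Rightarrow> complex) \<Rightarrow> complex" where
  "symm_part x S u = (1 - (\<Prod>i\<in>S. u i)) / (\<Prod>i\<in>S. 1 - u i) * (\<Prod>i\<in>S. u i powi (- x))"

definition weight :: "int \<Rightarrow> nat set \<Rightarrow> (nat \<Rightarrow> complex) \<Rightarrow> complex" where
  "weight x S u = (\<Prod>(i, j)\<in>pairs S. K (u i) (u j)) * symm_part x S u"

text \<open>The right-hand side of the theorem with two parts left open: \<open>c\<close> holds
  coefficients that depend on the size of \<open>S\<close> only, and \<open>h\<close> is the factor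
  produced by time, which is 1 at the start, a power of \<open>multiplier\<close> after some rings
  and an exponential at time t. The indices of \<open>y\<close> start at 1.\<close>

definition combination ::
  "nat \<Rightarrow> int \<Rightarrow> (nat \<Rightarrow> complex) \<Rightarrow> (nat set \<Rightarrow> (nat \<Rightarrow> complex) \<Rightarrow> complex) \<Rightarrow> (nat \<Rightarrow> nat) \<Rightarrow> complex" where
  "combination N x c h y = (\<Sum>S\<in>Pow {1..N}. c (card S) * \<beta> ^ kappa S
     * tmean S (\<lambda>u. weight x S u * (\<Prod>i\<in>S. u i ^ y i) * h S u))"

lemma nice_symm_part [nice_intros]: "nice {} (symm_part x S)"
proof -
  have "(\<Prod>i\<in>S. 1 - u i) \<noteq> 0" if "u \<in> polydisc" for u
    by (cases "finite S") (use polydisc_1[OF that] in auto)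
  then show ?thesis
    unfolding symm_part_def [abs_def] by (intro nice_intros) auto
qed

lemma nice_weight [nice_intros]: "nice {} (weight x S)"
  unfolding weight_def [abs_def] case_prod_beta' by (intro nice_intros)

lemma nice_if [nice_intros]: "(P \<Longrightarrow> nice J f) \<Longrightarrow> (\<not> P \<Longrightarrow> nice J g) \<Longrightarrow> nice J (\<lambda>u. if P then f u else g u)"
  by (cases P) auto

lemma sum_involution_eq_0:
  fixes f :: "'a \<Rightarrow> complex"
  assumes "\<And>S. S \<in> A \<Longrightarrow> \<tau> S \<in> A" "\<And>S. S \<in> A \<Longrightarrow> \<tau> (\<tau> S) = S" "\<And>S. S \<in> A \<Longrightarrow> f (\<tau> S) = - f S"
  shows "sum f A = 0"
proof -
  have "sum f A = (\<Sum>S\<in>A. f (\<tau> S))"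
    by (rule sum.reindex_bij_witness[of _ \<tau> \<tau>]) (use assms in auto)
  also have "\<dots> = - sum f A" using assms(3) by (simp add: sum_negf)
  finally show ?thesis by simp
qed

text \<open>When \<open>y p = y (p + 1)\<close>, the free evolution of particle \<open>p + 1\<close> agrees with pushing on
  particle \<open>p\<close>: the difference of the two one-particle factors is cancelled against \<open>K\<close> if both
  particles are in \<open>S\<close>, and against the weight \<open>b ^ kappa S\<close> if exactly one is.\<close>
lemma combination_boundary:
  assumes y: "y p = y (Suc p)" and p: "1 \<le> p" "Suc p \<le> N"
    and h: "\<And>S. nice {} (h S)"
    and h_equiv: "\<And>S u. h (Transposition.transpose p (Suc p) ` S) u = h S (u \<circ> Transposition.transpose p (Suc p))"
  shows "combination N x c (\<lambda>S u. h S u * (if Suc p \<in> S then (1 - \<beta>) * u (Suc p) / (1 - \<beta> * u (Suc p)) else 1)) y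
    = combination N x c (\<lambda>S u. h S u * (if p \<in> S then (1 - \<beta>) / (1 - \<beta> * u p) else 1)) y"
proof -
  define \<tau> where "\<tau> = Transposition.transpose p (Suc p)"
  have \<tau>\<tau>: "\<tau> (\<tau> i) = i" "bij \<tau>" "inv \<tau> = \<tau>" for i by (simp_all add: \<tau>_def inv_equality)
  have y\<tau>: "y (\<tau> i) = y i" for i using y by (simp add: \<tau>_def Transposition.transpose_def)
  have injt: "inj_on \<tau> A" for A by (simp add: \<tau>_def)
  define \<delta> where "\<delta> S u = (if Suc p \<in> S then (1 - \<beta>) * u (Suc p) / (1 - \<beta> * u (Suc p)) else 1)
      - (if p \<in> S then (1 - \<beta>) / (1 - \<beta> * u p) else 1)" for S u
  define sym where "sym S u = symm_part x S u * (\<Prod>i\<in>S. u i ^ y i) * h S u" for S u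
  define rest where "rest S u = (\<Prod>(i, j)\<in>pairs S - {(p, Suc p)}. K (u i) (u j))" for S u
  define I where "I S u = weight x S u * (\<Prod>i\<in>S. u i ^ y i) * (h S u * \<delta> S u)" for S u
  define f where "f S = c (card S) * \<beta> ^ kappa S * tmean S (I S)" for S
  have nice\<delta>: "nice {} (\<delta> S)" for S
    unfolding \<delta>_def [abs_def] by (intro nice_intros polydisc_1')
  have niceI: "nice {} (I S)" for S
    unfolding I_def [abs_def] by (intro nice_intros h nice\<delta>)
  have prod\<tau>: "(\<Prod>i\<in>\<tau> ` S. g i ((u \<circ> \<tau>) i)) = (\<Prod>i\<in>S. g (\<tau> i) (u i))" for g :: "nat \<Rightarrow> complex \<Rightarrow> complex" and S u
    by (simp add: prod.reindex[OF injt] \<tau>\<tau>)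
  have sym\<tau>: "sym (\<tau> ` S) (u \<circ> \<tau>) = sym S u" for S u
  proof -
    have "h (\<tau> ` S) (u \<circ> \<tau>) = h S (u \<circ> \<tau> \<circ> \<tau>)" unfolding \<tau>_def by (rule h_equiv)
    moreover have "u \<circ> \<tau> \<circ> \<tau> = u" by (auto simp: \<tau>\<tau>)
    ultimately show ?thesis
      unfolding sym_def symm_part_def
      using prod\<tau>[of "\<lambda>_ w. w"] prod\<tau>[of "\<lambda>_ w. 1 - w"] prod\<tau>[of "\<lambda>_ w. w powi (- x)"] prod\<tau>[of "\<lambda>i w. w ^ y i"] y\<tau>
      by (simp del: comp_apply)
  qed
  have rest\<tau>: "rest (\<tau> ` S) (u \<circ> \<tau>) = rest S u" for S u
  proof -
    \<comment> \<open>Exchanging two neighbouring numbers reverses the order of the pair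
      \<open>(p, Suc p)\<close> and of no other.\<close>
    have mono: "(\<tau> i, \<tau> j) \<in> pairs (\<tau> ` S) - {(p, Suc p)}" if "(i, j) \<in> pairs S - {(p, Suc p)}" for i j S
      using that unfolding pairs_def by (auto simp: \<tau>_def Transposition.transpose_def)
    have \<tau>S: "\<tau> ` \<tau> ` S = S" by (simp add: image_image \<tau>\<tau>)
    have mono': "map_prod \<tau> \<tau> q \<in> pairs (\<tau> ` S) - {(p, Suc p)}" if "q \<in> pairs S - {(p, Suc p)}" for q S
      using mono[of "fst q" "snd q" S] that by (cases q) (simp only: map_prod_simp fst_conv snd_conv)
    have inv: "map_prod \<tau> \<tau> (map_prod \<tau> \<tau> q) = q" for q by (cases q) (simp add: \<tau>\<tau>)
    show ?thesis
      unfolding rest_def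
    proof (rule prod.reindex_bij_witness[of _ "map_prod \<tau> \<tau>" "map_prod \<tau> \<tau>"], goal_cases)
      case (2 q)
      then show ?case using mono'[of q "\<tau> ` S"] \<tau>S by simp
    next
      case (5 q)
      show ?case by (cases q) simp
    qed (rule inv mono'; assumption)+
  qed
  have one: "f (\<tau> ` S) = - f S" if S: "finite S" "p \<in> S" "Suc p \<notin> S" for S
  proof -
    have S\<tau>: "\<tau> ` S = insert (Suc p) (S - {p})"
      using S by (auto simp: \<tau>_def Transposition.transpose_def image_iff)
    have card: "card (\<tau> ` S) = card S" by (rule card_image[OF injt])
    have "\<Sum>S = p + \<Sum>(S - {p})" using S by (intro sum.remove)
    then have kap: "kappa (\<tau> ` S) = Suc (kappa S)"
      using S by (simp add: kappa_def S\<tau>)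
    have "\<beta> * tmean (\<tau> ` S) (I (\<tau> ` S)) = \<beta> * tmean S (\<lambda>u. I (\<tau> ` S) (u \<circ> \<tau>))"
      using tmean_transpose[OF \<tau>\<tau>(2) S(1) niceI] \<tau>\<tau>(3) by simp
    also have "\<dots> = tmean S (\<lambda>u. \<beta> * I (\<tau> ` S) (u \<circ> \<tau>))" by (simp add: tmean_mult_left)
    also have "\<dots> = tmean S (\<lambda>u. (- 1) * I S u)"
    proof (rule tmean_cong)
      fix u assume u: "u \<in> torus r"
      have nopair: "pairs S = pairs S - {(p, Suc p)}" "pairs (\<tau> ` S) = pairs (\<tau> ` S) - {(p, Suc p)}"
        using S by (auto simp: pairs_def S\<tau>)
      have 1: "1 - \<beta> * u p \<noteq> 0" by (intro polydisc_1' torus_polydisc u)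
      \<comment> \<open>The value of \<open>\<delta>\<close> is
        \<open>(u p - 1) / (1 - \<beta> * u p)\<close> for the swapped set and
        \<open>\<beta> * (1 - u p) / (1 - \<beta> * u p)\<close> for \<open>S\<close>. Their
        quotient is minus \<open>\<beta>\<close>, which is the factor gained when
        \<open>kappa\<close> increases by one.\<close>
      have "\<beta> * \<delta> (\<tau> ` S) (u \<circ> \<tau>) = \<beta> * ((1 - \<beta>) * u p / (1 - \<beta> * u p) - 1)"
        using S by (simp add: \<delta>_def S\<tau>) (simp add: \<tau>_def)
      also have "\<dots> = - (1 - (1 - \<beta>) / (1 - \<beta> * u p))"
        using 1 by (simp add: field_simps)
      also have "\<dots> = - \<delta> S u" using S by (simp add: \<delta>_def)
      finally have d: "\<beta> * \<delta> (\<tau> ` S) (u \<circ> \<tau>) = - \<delta> S u" .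
      have "\<beta> * I (\<tau> ` S) (u \<circ> \<tau>) = rest (\<tau> ` S) (u \<circ> \<tau>) * sym (\<tau> ` S) (u \<circ> \<tau>) * (\<beta> * \<delta> (\<tau> ` S) (u \<circ> \<tau>))"
        unfolding I_def weight_def sym_def rest_def nopair(2)[symmetric] by (simp only: mult_ac)
      also have "\<dots> = - (rest S u * sym S u * \<delta> S u)"
        unfolding rest\<tau> sym\<tau> d by simp
      also have "\<dots> = (- 1) * I S u"
        unfolding I_def weight_def sym_def rest_def nopair(1)[symmetric] by (simp add: mult_ac)
      finally show "\<beta> * I (\<tau> ` S) (u \<circ> \<tau>) = (- 1) * I S u" .
    qed
    also have "\<dots> = - tmean S (I S)" unfolding tmean_mult_left by simp
    finally have "\<beta> * tmean (\<tau> ` S) (I (\<tau> ` S)) = - tmean S (I S)" .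
    then have "c (card S) * \<beta> ^ kappa S * (\<beta> * tmean (\<tau> ` S) (I (\<tau> ` S))) = - (c (card S) * \<beta> ^ kappa S * tmean S (I S))"
      by simp
    then show ?thesis unfolding f_def card kap by (simp add: mult_ac)
  qed
  have both: "f S = 0" if S: "finite S" "p \<in> S" "Suc p \<in> S" for S
  proof -
    have S\<tau>: "\<tau> ` S = S" using S by (simp add: \<tau>_def)
    have "tmean S (I S) = tmean S (\<lambda>u. I S (u \<circ> \<tau>))"
      using tmean_transpose[OF \<tau>\<tau>(2) S(1) niceI] \<tau>\<tau>(3) S\<tau> by simp
    also have "\<dots> = tmean S (\<lambda>u. (- 1) * I S u)"
    proof (rule tmean_cong)
      fix u assume u: "u \<in> torus r"
      define g where "g x w = \<beta> * (1 - \<beta>) / ((1 - \<beta> * x) * (1 - \<beta> * w))" for x w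
      have I: "I S u = rest S u * sym S u * (- g (u p) (u (Suc p)) * (u p - u (Suc p)))" if u: "u \<in> torus r" for u
      proof -
        have "(\<Prod>(i, j)\<in>pairs S. K (u i) (u j)) = K (u p) (u (Suc p)) * rest S u"
          unfolding rest_def using S by (subst prod.remove[of _ "(p, Suc p)"]) (auto simp: pairs_def intro: finite_pairs[unfolded pairs_def])
        then have "I S u = rest S u * sym S u * (K (u p) (u (Suc p)) * \<delta> S u)"
          unfolding I_def weight_def sym_def by (simp add: mult_ac)
        moreover have "K (u p) (u (Suc p)) * \<delta> S u = - g (u p) (u (Suc p)) * (u p - u (Suc p))"
        proof -
          have 1: "1 - \<beta> * u p \<noteq> 0" "1 - \<beta> * u (Suc p) \<noteq> 0" by (intro polydisc_1' torus_polydisc u)+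
          have 2: "D (u p) (u (Suc p)) \<noteq> 0" by (intro polydisc_D torus_polydisc u)
          have "\<delta> S u = ((1 - \<beta>) * u (Suc p) * (1 - \<beta> * u p) - (1 - \<beta>) * (1 - \<beta> * u (Suc p))) / ((1 - \<beta> * u p) * (1 - \<beta> * u (Suc p)))"
            using S 1 by (simp add: \<delta>_def diff_frac_eq mult_ac)
          \<comment> \<open>The numerator of the difference of the two one-particle factors is a
            multiple of \<open>D\<close>: this identity dictates the denominator of the
            kernel.\<close>
          also have "(1 - \<beta>) * u (Suc p) * (1 - \<beta> * u p) - (1 - \<beta>) * (1 - \<beta> * u (Suc p)) = - (1 - \<beta>) * D (u p) (u (Suc p))"
            by (simp add: D_def algebra_simps)
          finally have "\<delta> S u = - (1 - \<beta>) * D (u p) (u (Suc p)) / ((1 - \<beta> * u p) * (1 - \<beta> * u (Suc p)))" .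
          moreover have "\<beta> * a / d * (- e * d / q) = - (\<beta> * e / q) * a" if "d \<noteq> 0" for a d e q :: complex
            using that by simp
          ultimately show ?thesis using 2 unfolding K_def g_def by (simp only:)
        qed
        ultimately show ?thesis by simp
      qed
      have u\<tau>: "u \<circ> \<tau> \<in> torus r" using u by (simp add: torus_def)
      have g: "g w v = g v w" for v w by (simp add: g_def mult.commute)
      show "I S (u \<circ> \<tau>) = (- 1) * I S u"
        unfolding I[OF u] I[OF u\<tau>]
        using rest\<tau>[of S u] sym\<tau>[of S u] S\<tau> g[of "u p"]
        by (simp add: \<tau>_def algebra_simps del: comp_apply) (simp add: algebra_simps)
    qed
    also have "\<dots> = - tmean S (I S)" unfolding tmean_mult_left by simp
    finally show ?thesis by (simp add: f_def)
  qed
  have none: "f S = 0" if "p \<notin> S" "Suc p \<notin> S" for S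
  proof -
    have "I S = (\<lambda>u. 0 * 0)" using that by (auto simp: I_def \<delta>_def)
    then show ?thesis using tmean_mult_left[of S 0 "\<lambda>_. 0"] by (simp add: f_def)
  qed
  have "sum f (Pow {1..N}) = 0"
  proof (rule sum_involution_eq_0[where \<tau> = "(`) \<tau>"])
    fix S assume "S \<in> Pow {1..N}"
    then have S: "S \<subseteq> {1..N}" "finite S" by (auto intro: finite_subset)
    show "\<tau> ` S \<in> Pow {1..N}" using S(1) p by (auto simp: \<tau>_def Transposition.transpose_def)
    show \<tau>\<tau>S: "\<tau> ` \<tau> ` S = S" by (simp add: image_image \<tau>\<tau>)
    show "f (\<tau> ` S) = - f S"
    proof (cases "p \<in> S \<longleftrightarrow> Suc p \<in> S")
      case True
      then have "\<tau> ` S = S" by (simp add: \<tau>_def)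
      then show ?thesis using True both[OF S(2)] none[of S] by auto
    next
      case False
      show ?thesis
      proof (cases "p \<in> S")
        case True
        then show ?thesis using one[OF S(2)] False by auto
      next
        case p: False
        have "p \<in> \<tau> ` S" "Suc p \<notin> \<tau> ` S" using p False by (auto simp: \<tau>_def Transposition.transpose_def image_iff split: if_splits)
        then show ?thesis using one[of "\<tau> ` S"] S \<tau>\<tau>S by simp
      qed
    qed
  qed
  moreover have "f S = c (card S) * \<beta> ^ kappa S * tmean S (\<lambda>u. weight x S u * (\<Prod>i\<in>S. u i ^ y i)
        * (h S u * (if Suc p \<in> S then (1 - \<beta>) * u (Suc p) / (1 - \<beta> * u (Suc p)) else 1)))
      - c (card S) * \<beta> ^ kappa S * tmean S (\<lambda>u. weight x S u * (\<Prod>i\<in>S. u i ^ y i)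
        * (h S u * (if p \<in> S then (1 - \<beta>) / (1 - \<beta> * u p) else 1)))" for S
    unfolding f_def I_def [abs_def] \<delta>_def right_diff_distrib
    by (subst tmean_diff) (intro nice_intros h polydisc_1' | simp add: right_diff_distrib)+
  ultimately show ?thesis
    unfolding combination_def by (simp add: sum_subtractf)
qed

end

section \<open>One ring of the clocks\<close>

declare hl_activate.simps [simp del]

lemma expectation_nat_pmf_sums:
  fixes f :: "nat \<Rightarrow> complex"
  assumes "\<And>n. cmod (f n) \<le> B"
  shows "(\<lambda>n. of_real (pmf p n) * f n) sums measure_pmf.expectation p f"
proof -
  have "integrable (measure_pmf p) f"
    by (rule measure_pmf.integrable_const_bound[where B = B]) (use assms in auto)
  then have "integrable (count_space UNIV) (\<lambda>n. pmf p n *\<^sub>R f n)"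
    "measure_pmf.expectation p f = (\<integral>n. pmf p n *\<^sub>R f n \<partial>count_space UNIV)"
    unfolding measure_pmf_eq_density
    by (simp_all add: integrable_density integral_density)
  then show ?thesis
    using sums_integral_count_space_nat by (simp add: scaleR_conv_of_real)
qed

lemma expectation_bind_pmf:
  fixes f :: "'b \<Rightarrow> complex"
  assumes "\<And>y. cmod (f y) \<le> B"
  shows "measure_pmf.expectation (bind_pmf p q) f
    = measure_pmf.expectation p (\<lambda>x. measure_pmf.expectation (q x) f)"
proof -
  have real: "measure_pmf.expectation (bind_pmf p q) g = measure_pmf.expectation p (\<lambda>x. measure_pmf.expectation (q x) g)"
    if "\<And>y. \<bar>g y\<bar> \<le> B" for g :: "'b \<Rightarrow> real"
    unfolding measure_pmf_bind using measurable_measure_pmf[of q]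
    by (intro integral_bind[where K = "count_space UNIV" and B = B and B' = 1])
      (use that in \<open>auto simp: measure_pmf.finite_measure measure_pmf.emeasure_space_1 simp flip: measure_pmf.emeasure_space_1\<close>)
  have int: "integrable (measure_pmf p') f" for p'
    by (rule measure_pmf.integrable_const_bound[where B = B]) (use assms in auto)
  have "cmod (measure_pmf.expectation (q x) f) \<le> B" for x
    using assms by (intro order_trans[OF integral_norm_bound] measure_pmf.integral_le_const) (auto intro!: integrable_norm int)
  then have int': "integrable (measure_pmf p) (\<lambda>x. measure_pmf.expectation (q x) f)"
    by (intro measure_pmf.integrable_const_bound[where B = B]) auto
  have ReIm: "\<bar>Re (f y)\<bar> \<le> B" "\<bar>Im (f y)\<bar> \<le> B" for y
    using assms[of y] abs_Re_le_cmod[of "f y"] abs_Im_le_cmod[of "f y"] by linarith+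
  show ?thesis
    using int int' real[of "\<lambda>y. Re (f y)", OF ReIm(1)] real[of "\<lambda>y. Im (f y)", OF ReIm(2)] by (simp add: complex_eq_iff)
qed

section \<open>Effect of one activation on the combination\<close>

context hl_contours
begin

lemma nice_bounded:
  assumes "nice J f"
  obtains C where "0 < C" "\<And>u. u \<in> torus r \<Longrightarrow> cmod (f u) \<le> C"
proof -
  have "bounded (f ` torus r)"
    by (intro compact_imp_bounded compact_continuous_image nice_continuous[OF assms] compact_torus)
  then show thesis using that unfolding bounded_pos by blast
qed

lemma tmean_sums:
  assumes "\<And>n. nice {} (g n)" "nice {} G" "\<And>v. v \<in> torus r \<Longrightarrow> (\<lambda>n. g n v) sums G v"
    and "\<And>n v. v \<in> torus r \<Longrightarrow> cmod (g n v) \<le> B n" "summable B"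
  shows "(\<lambda>n. tmean S (g n)) sums tmean S G"
  unfolding tmean_def
  by (rule torus_mean_sums[where B = B, OF r_pos nice_continuous[OF assms(1)] nice_continuous[OF assms(2)] assms(3-5) base_torus])

lemma norm_tmean_le: "nice {} G \<Longrightarrow> (\<And>v. v \<in> torus r \<Longrightarrow> cmod (G v) \<le> B) \<Longrightarrow> cmod (tmean S G) \<le> B"
  unfolding tmean_def by (intro norm_torus_mean_le r_pos nice_continuous base_torus)

lemma torus_norm_le_1: "u \<in> torus r \<Longrightarrow> cmod (u i) \<le> 1"
  using r_less by (simp add: torus_def)

lemma norm_prod_power_le_1: "u \<in> torus r \<Longrightarrow> cmod (\<Prod>i\<in>S. u i ^ y i) \<le> 1"
  by (auto simp: prod_norm[symmetric] norm_power intro!: prod_le_1 power_le_one torus_norm_le_1)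

text \<open>Positions are natural numbers and the variables have modulus below 1, so the powers that
  contain \<open>y\<close> are at most 1. Uniformity in \<open>y\<close> is what allows expectations
  over infinitely many configurations to be written as series.\<close>

lemma combination_bounded:
  assumes "\<And>S. nice {} (h S)"
  shows "\<exists>B. \<forall>y. cmod (combination N x c h y) \<le> B"
proof -
  have "\<exists>B. \<forall>y. cmod (tmean S (\<lambda>u. weight x S u * (\<Prod>i\<in>S. u i ^ y i) * h S u)) \<le> B" for S
  proof -
    have "nice {} (\<lambda>u. weight x S u * h S u)" by (intro nice_intros assms)
    then obtain C where C: "0 < C" "\<And>u. u \<in> torus r \<Longrightarrow> cmod (weight x S u * h S u) \<le> C"
      by (rule nice_bounded) blast
    have "cmod (tmean S (\<lambda>u. weight x S u * (\<Prod>i\<in>S. u i ^ y i) * h S u)) \<le> C" for y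
    proof (rule norm_tmean_le)
      fix u assume u: "u \<in> torus r"
      have "cmod (weight x S u * h S u) * cmod (\<Prod>i\<in>S. u i ^ y i) \<le> C * 1"
        by (intro mult_mono C u norm_prod_power_le_1) (use C(1) in auto)
      then show "cmod (weight x S u * (\<Prod>i\<in>S. u i ^ y i) * h S u) \<le> C"
        by (simp add: norm_mult mult_ac)
    qed (intro nice_intros assms)
    then show ?thesis by blast
  qed
  then have "\<forall>S. \<exists>B. \<forall>y. cmod (tmean S (\<lambda>u. weight x S u * (\<Prod>i\<in>S. u i ^ y i) * h S u)) \<le> B"
    by blast
  from choice[OF this] obtain B where B: "\<And>S y. cmod (tmean S (\<lambda>u. weight x S u * (\<Prod>i\<in>S. u i ^ y i) * h S u)) \<le> B S"
    by blast
  have "cmod (combination N x c h y) \<le> (\<Sum>S\<in>Pow {1..N}. cmod (c (card S) * \<beta> ^ kappa S) * B S)" for y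
    unfolding combination_def
  proof (rule sum_norm_le)
    fix S
    show "cmod (c (card S) * \<beta> ^ kappa S * tmean S (\<lambda>u. weight x S u * (\<Prod>i\<in>S. u i ^ y i) * h S u))
      \<le> cmod (c (card S) * \<beta> ^ kappa S) * B S"
      unfolding norm_mult[of "c (card S) * \<beta> ^ kappa S"] by (rule mult_left_mono[OF B norm_ge_zero])
  qed
  then show ?thesis by blast
qed

lemma combination_cong:
  "(\<And>i. i \<in> {1..N} \<Longrightarrow> y i = y' i) \<Longrightarrow> combination N x c h y = combination N x c h y'"
  unfolding combination_def
  by (intro sum.cong refl arg_cong2[where f = "(*)"] arg_cong2[where f = tmean] ext prod.cong)
    (auto simp: subset_iff)

text \<open>A geometric series in \<open>\<beta> * u p\<close>, summed under the mean. With
  \<open>d = 1\<close> it describes a free jump; with \<open>d = 0\<close> the displacement may be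
  0, as for a jump continued from a site already reached.\<close>

lemma combination_sums:
  assumes h: "\<And>S. nice {} (h S)" and p: "p \<in> {1..N}"
  shows "(\<lambda>g. (1 - \<beta>) * \<beta> ^ g * combination N x c h (y(p := y p + d + g))) sums
    combination N x c (\<lambda>S u. h S u * (if p \<in> S then (1 - \<beta>) * u p ^ d / (1 - \<beta> * u p) else 1)) y"
proof -
  have b1: "cmod \<beta> < 1" "1 - \<beta> \<noteq> 0" using b_pos b_less_1 by auto
  have "(\<lambda>g. (1 - \<beta>) * \<beta> ^ g * tmean S (\<lambda>u. weight x S u * (\<Prod>i\<in>S. u i ^ (y(p := y p + d + g)) i) * h S u)) sums
    tmean S (\<lambda>u. weight x S u * (\<Prod>i\<in>S. u i ^ y i) * (h S u * (if p \<in> S then (1 - \<beta>) * u p ^ d / (1 - \<beta> * u p) else 1)))"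
    if S: "S \<in> Pow {1..N}" for S
  proof (cases "p \<in> S")
    case False
    then have "(\<Prod>i\<in>S. u i ^ (y(p := y p + d + g)) i) = (\<Prod>i\<in>S. u i ^ y i)" for g and u :: "nat \<Rightarrow> complex"
      by (intro prod.cong) auto
    moreover have "(\<lambda>g. (1 - \<beta>) * \<beta> ^ g) sums 1"
      using sums_mult[OF geometric_sums[OF b1(1)], of "1 - \<beta>"] b1(2) by simp
    ultimately show ?thesis using sums_mult2[of "\<lambda>g. (1 - \<beta>) * \<beta> ^ g" 1] False by simp
  next
    case True
    have fin: "finite S" using S by (auto intro: finite_subset)
    have prod: "(\<Prod>i\<in>S. u i ^ (y(p := y p + d + g)) i) = u p ^ d * u p ^ g * (\<Prod>i\<in>S. u i ^ y i)"
      for g and u :: "nat \<Rightarrow> complex"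
      using True fin by (simp add: prod.remove[of S p] power_add mult_ac)
    define F where "F u = weight x S u * (\<Prod>i\<in>S. u i ^ y i) * (h S u * (1 - \<beta>) * u p ^ d)" for u
    have nF: "nice {} F" unfolding F_def [abs_def] by (intro nice_intros h)
    then obtain C where C: "0 < C" "\<And>u. u \<in> torus r \<Longrightarrow> cmod (F u) \<le> C"
      by (rule nice_bounded) blast
    have "(\<lambda>g. tmean S (\<lambda>u. F u * (\<beta> * u p) ^ g)) sums tmean S (\<lambda>u. F u * (1 / (1 - \<beta> * u p)))"
    proof (rule tmean_sums)
      show "nice {} (\<lambda>u. F u * (\<beta> * u p) ^ g)" for g by (intro nice_intros nF)
      show "nice {} (\<lambda>u. F u * (1 / (1 - \<beta> * u p)))" by (intro nice_intros nF polydisc_1')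
      fix u assume u: "u \<in> torus r"
      have le: "cmod (\<beta> * u p) \<le> b"
        using mult_left_mono[OF torus_norm_le_1[OF u, of p], of b] b_pos by (simp add: norm_mult)
      then have "cmod (\<beta> * u p) < 1" using b_less_1 by simp
      then show "(\<lambda>g. F u * (\<beta> * u p) ^ g) sums (F u * (1 / (1 - \<beta> * u p)))"
        by (intro sums_mult geometric_sums)
      show "cmod (F u * (\<beta> * u p) ^ g) \<le> C * b ^ g" for g
        unfolding norm_mult[of "F u"] norm_power
        by (intro mult_mono C u power_mono le) (use C(1) in auto)
    next
      show "summable (\<lambda>g. C * b ^ g)" using b_pos b_less_1 by (intro summable_mult summable_geometric) auto
    qed
    moreover have "tmean S (\<lambda>u. F u * (\<beta> * u p) ^ g)
      = (1 - \<beta>) * \<beta> ^ g * tmean S (\<lambda>u. weight x S u * (\<Prod>i\<in>S. u i ^ (y(p := y p + d + g)) i) * h S u)" for g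
      unfolding tmean_mult_left[symmetric] prod
      by (intro arg_cong2[where f = tmean] ext) (auto simp: F_def power_mult_distrib)
    moreover have "tmean S (\<lambda>u. F u * (1 / (1 - \<beta> * u p)))
      = tmean S (\<lambda>u. weight x S u * (\<Prod>i\<in>S. u i ^ y i) * (h S u * (if p \<in> S then (1 - \<beta>) * u p ^ d / (1 - \<beta> * u p) else 1)))"
      using True by (intro arg_cong2[where f = tmean] ext) (auto simp: F_def)
    ultimately show ?thesis by simp
  qed
  then have "(\<lambda>g. \<Sum>S\<in>Pow {1..N}. c (card S) * \<beta> ^ kappa S *
      ((1 - \<beta>) * \<beta> ^ g * tmean S (\<lambda>u. weight x S u * (\<Prod>i\<in>S. u i ^ (y(p := y p + d + g)) i) * h S u))) sums
    combination N x c (\<lambda>S u. h S u * (if p \<in> S then (1 - \<beta>) * u p ^ d / (1 - \<beta> * u p) else 1)) y"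
    unfolding combination_def by (intro sums_sum sums_mult)
  then show ?thesis unfolding combination_def sum_distrib_left by (simp only: mult_ac)
qed

definition positions :: "nat list \<Rightarrow> nat \<Rightarrow> nat" where
  "positions xs p = xs ! (p - 1)"

lemma combination_positions_update:
  "i < length xs \<Longrightarrow> length xs = N \<Longrightarrow>
    combination N x c h (positions (xs[i := a])) = combination N x c h ((positions xs)(Suc i := a))"
  by (rule combination_cong) (auto simp: positions_def nth_list_update)

text \<open>The activation is compared with a free jump of the same particle. Short of the neighbour
  the two agree. Beyond it the free jump, being memoryless, restarts at the neighbour's site, and
  there \<open>combination_boundary\<close> turns it into the activation of the neighbour, which the
  induction covers. Order is assumed only from \<open>i\<close> on, because a pushed particle shares
  its site with its left neighbour.\<close>

lemma expectation_hl_activate: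
  assumes h: "\<And>S. nice {} (h S)"
    and h_equiv: "\<And>p S u. 1 \<le> p \<Longrightarrow> Suc p \<le> N \<Longrightarrow>
      h (Transposition.transpose p (Suc p) ` S) u = h S (u \<circ> Transposition.transpose p (Suc p))"
    and "length xs = N" "i < N" "\<And>l. i \<le> l \<Longrightarrow> Suc l < N \<Longrightarrow> xs ! l < xs ! Suc l"
  shows "measure_pmf.expectation (hl_activate b xs i) (\<lambda>ys. combination N x c h (positions ys))
    = combination N x c (\<lambda>S u. h S u * (if Suc i \<in> S then (1 - \<beta>) * u (Suc i) / (1 - \<beta> * u (Suc i)) else 1)) (positions xs)"
  using assms(3-)
proof (induction "N - i" arbitrary: xs i)
  case 0
  then show ?case by simp
next
  case (Suc n)
  let ?\<phi> = "\<lambda>ys. combination N x c h (positions ys)"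
  let ?L = "combination N x c (\<lambda>S u. h S u * (if Suc i \<in> S then (1 - \<beta>) * u (Suc i) / (1 - \<beta> * u (Suc i)) else 1)) (positions xs)"
  obtain B where B: "\<And>y. cmod (combination N x c h y) \<le> B"
    using combination_bounded[of h N x c, OF h] by blast
  define xs' where "xs' = xs[i := xs ! Suc i]"
  define C where "C = measure_pmf.expectation (hl_activate b xs' (Suc i)) ?\<phi>"
  define push where "push g \<longleftrightarrow> Suc i < N \<and> xs ! Suc i \<le> xs ! i + Suc g" for g
  define F where "F g = (if push g then C else ?\<phi> (xs[i := xs ! i + Suc g]))" for g
  define f where "f g = (1 - \<beta>) * \<beta> ^ g * ?\<phi> (xs[i := xs ! i + Suc g])" for g
  have "measure_pmf.expectation (hl_activate b xs i) ?\<phi> = measure_pmf.expectation (geometric_pmf (1 - b)) F"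
    unfolding hl_activate.simps[of b xs i] using Suc.prems
    by (auto simp: expectation_bind_pmf[OF B] F_def push_def C_def xs'_def intro!: Bochner_Integration.integral_cong)
  moreover have "(\<lambda>g. of_real (pmf (geometric_pmf (1 - b)) g) * F g) sums measure_pmf.expectation (geometric_pmf (1 - b)) F"
    by (rule expectation_nat_pmf_sums[where B = "max B (cmod C)"]) (auto simp: F_def intro: max.coboundedI1 B)
  ultimately have E: "(\<lambda>g. (1 - \<beta>) * \<beta> ^ g * F g) sums measure_pmf.expectation (hl_activate b xs i) ?\<phi>"
    using b_pos b_less_1 by (simp add: mult_ac)
  have L: "f sums ?L"
    using combination_sums[where h = h and p = "Suc i" and N = N and x = x and c = c and y = "positions xs" and d = 1, OF h] Suc.prems
    by (simp add: f_def[abs_def] combination_positions_update cong: if_cong) (simp add: positions_def)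
  show ?case
  proof (cases "Suc i < N")
    case False
    then have "f = (\<lambda>g. (1 - \<beta>) * \<beta> ^ g * F g)" by (simp add: F_def push_def f_def [abs_def])
    with L show ?thesis by (intro sums_unique2[OF E]) simp
  next
    case True
    \<comment> \<open>The jump length is \<open>Suc g\<close>, so the neighbour is reached exactly
      when \<open>d \<le> g\<close>.\<close>
    define d where "d = xs ! Suc i - Suc (xs ! i)"
    have lt: "xs ! i < xs ! Suc i" using Suc.prems(3)[of i] True by simp
    \<comment> \<open>The induction hypothesis puts the factor on the pushed neighbour. In
      \<open>xs'\<close> the two positions coincide, so the boundary condition moves it to the
      pushing particle, in the form that belongs to displacement 0 or more.\<close>
    have "C = combination N x c (\<lambda>S u. h S u * (if Suc (Suc i) \<in> S then (1 - \<beta>) * u (Suc (Suc i)) / (1 - \<beta> * u (Suc (Suc i))) else 1)) (positions xs')"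
      unfolding C_def using Suc.prems Suc.hyps(2) True
      by (intro Suc.hyps(1)) (auto simp: xs'_def nth_list_update)
    also have "\<dots> = combination N x c (\<lambda>S u. h S u * (if Suc i \<in> S then (1 - \<beta>) / (1 - \<beta> * u (Suc i)) else 1)) (positions xs')"
      using Suc.prems True
      by (intro combination_boundary h h_equiv) (auto simp: positions_def xs'_def nth_list_update)
    finally have "(\<lambda>g. (1 - \<beta>) * \<beta> ^ g * combination N x c h ((positions xs')(Suc i := positions xs' (Suc i) + 0 + g))) sums C"
      using combination_sums[where h = h and p = "Suc i" and N = N and x = x and c = c and y = "positions xs'" and d = 0, OF h] Suc.prems by (simp cong: if_cong)
    moreover have "combination N x c h ((positions xs')(Suc i := positions xs' (Suc i) + 0 + g)) = ?\<phi> (xs[i := xs ! i + Suc (g + d)])" for g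
      using lt Suc.prems unfolding xs'_def
      by (intro combination_cong) (auto simp: positions_def nth_list_update d_def)
    ultimately have "(\<lambda>g. \<beta> ^ d * ((1 - \<beta>) * \<beta> ^ g * ?\<phi> (xs[i := xs ! i + Suc (g + d)]))) sums (\<beta> ^ d * C)"
      by (intro sums_mult) simp
    then have "(\<lambda>g. f (g + d)) sums (\<beta> ^ d * C)"
      by (simp add: f_def power_add mult_ac)
    then have "f sums (\<beta> ^ d * C + (\<Sum>g<d. f g))" by (simp add: sums_iff_shift)
    with L have LC: "?L = \<beta> ^ d * C + (\<Sum>g<d. f g)" by (rule sums_unique2)
    have "(\<lambda>g. \<beta> ^ d * C * (1 - \<beta>) * \<beta> ^ g) sums (\<beta> ^ d * C * (1 - \<beta>) * (1 / (1 - \<beta>)))"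
      using b_pos b_less_1 by (intro sums_mult geometric_sums) auto
    then have "(\<lambda>g. (1 - \<beta>) * \<beta> ^ (g + d) * F (g + d)) sums (\<beta> ^ d * C)"
    proof -
      have "F (g + d) = C" for g using True lt by (simp add: F_def push_def d_def)
      then show ?thesis using \<open>(\<lambda>g. \<beta> ^ d * C * (1 - \<beta>) * \<beta> ^ g) sums _\<close> b_less_1
        by (simp add: power_add mult_ac)
    qed
    then have "(\<lambda>g. (1 - \<beta>) * \<beta> ^ g * F g) sums (\<beta> ^ d * C + (\<Sum>g<d. (1 - \<beta>) * \<beta> ^ g * F g))"
      by (simp add: sums_iff_shift[of "\<lambda>g. (1 - \<beta>) * \<beta> ^ g * F g"])
    also have "(\<Sum>g<d. (1 - \<beta>) * \<beta> ^ g * F g) = (\<Sum>g<d. f g)"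
      by (intro sum.cong) (auto simp: F_def f_def push_def d_def)
    finally show ?thesis unfolding LC by (rule sums_unique2[OF E])
  qed
qed

end

section \<open>Gaussian binomial coefficients\<close>

text \<open>Pascal's rule is taken as the definition because the sums over subsets obey a parallel
  recursion in \<open>n\<close>. Where the subtraction truncates, that is for \<open>n < k\<close>,
  the coefficient it multiplies is 0.\<close>

fun gauss_binomial :: "real \<Rightarrow> nat \<Rightarrow> nat \<Rightarrow> real" where
  "gauss_binomial q n 0 = 1"
| "gauss_binomial q 0 (Suc k) = 0"
| "gauss_binomial q (Suc n) (Suc k) = q ^ (n - k) * gauss_binomial q n k + gauss_binomial q n (Suc k)"

lemma gauss_binomial_eq_0: "n < k \<Longrightarrow> gauss_binomial q n k = 0"
  by (induction q n k rule: gauss_binomial.induct) auto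

lemma qpoch_pos:
  fixes q :: real
  assumes "0 < q" "q < 1"
  shows "0 < qpoch q q k"
proof -
  have "q ^ Suc j < 1" for j using power_Suc_less_one[OF assms] .
  then have "0 < 1 - q * q ^ (j - 1)" for j by simp
  then show ?thesis unfolding qpoch_def by (intro prod_pos) blast
qed

lemma gauss_binomial_qpoch:
  assumes "0 < q" "q < 1" "k \<le> n"
  shows "gauss_binomial q n k * (qpoch q q k * qpoch q q (n - k)) = qpoch q q n"
  using assms(3)
proof (induction n arbitrary: k)
  case 0
  then show ?case by (simp add: qpoch_def)
next
  case (Suc n)
  have Suc_qpoch: "qpoch q q (Suc j) = qpoch q q j * (1 - q ^ Suc j)" for j
    by (simp add: qpoch_def)
  show ?case
  proof (cases k)
    case 0
    then show ?thesis by (simp add: qpoch_def)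
  next
    case [simp]: (Suc j)
    show ?thesis
    proof (cases "j = n")
      case True
      then show ?thesis
        using Suc.IH[of n] qpoch_pos[OF assms(1,2), of n] by (simp add: gauss_binomial_eq_0 Suc_qpoch qpoch_def[of q q 0])
    next
      case False
      then obtain d where d: "n = j + Suc d" using Suc.prems less_imp_Suc_add[of j n] by auto
      have 1: "gauss_binomial q n j * (qpoch q q j * qpoch q q (Suc d)) = qpoch q q n"
        using Suc.IH[of j] d by simp
      have 2: "gauss_binomial q n (Suc j) * (qpoch q q (Suc j) * qpoch q q d) = qpoch q q n"
        using Suc.IH[of "Suc j"] d by simp
      have "gauss_binomial q (Suc n) k * (qpoch q q k * qpoch q q (Suc n - k))
        = q ^ Suc d * (1 - q ^ Suc j) * (gauss_binomial q n j * (qpoch q q j * qpoch q q (Suc d)))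
          + (1 - q ^ Suc d) * (gauss_binomial q n (Suc j) * (qpoch q q (Suc j) * qpoch q q d))"
        by (simp add: d Suc_qpoch algebra_simps)
      also have "\<dots> = (q ^ Suc d * (1 - q ^ Suc j) + (1 - q ^ Suc d)) * qpoch q q n"
        unfolding 1 2 by (simp add: algebra_simps)
      also have "q ^ Suc d * (1 - q ^ Suc j) + (1 - q ^ Suc d) = 1 - q ^ Suc n"
        by (simp add: d power_add algebra_simps)
      finally show ?thesis by (simp add: Suc_qpoch)
    qed
  qed
qed

lemma qbinom_eq_gauss_binomial:
  assumes "0 < q" "q < 1" "k \<le> n"
  shows "qbinom q n k = gauss_binomial q n k"
proof -
  have Suc_qpoch: "qpoch a q (Suc j) = qpoch a q j * (1 - a * q ^ j)" for a j by (simp add: qpoch_def)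
  have "qpoch q q d * qpoch (q ^ (d + 1)) q k = qpoch q q (d + k)" for d
    by (induction k) (simp_all add: Suc_qpoch power_add mult_ac, simp add: qpoch_def)
  from this[of "n - k"]
  have "qpoch q q (n - k) * qpoch (q ^ (n - k + 1)) q k
      = qpoch q q (n - k) * (gauss_binomial q n k * qpoch q q k)"
    using gauss_binomial_qpoch[OF assms] assms(3) by (simp add: mult_ac)
  then show ?thesis
    using qpoch_pos[OF assms(1,2), of "n - k"] qpoch_pos[OF assms(1,2), of k]
    by (simp add: qbinom_def)
qed

section \<open>Subset sums as elementary symmetric polynomials of q, q^2, ..., q^n\<close>

definition subset_sum :: "real \<Rightarrow> nat \<Rightarrow> nat \<Rightarrow> real" where
  "subset_sum q n k = (\<Sum>S\<in>{S. S \<subseteq> {1..n} \<and> card S = k}. q ^ kappa S)"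

lemma subset_sum_0 [simp]: "subset_sum q n 0 = 1"
proof -
  have "{S. S \<subseteq> {1..n} \<and> card S = 0} = {{}}"
  proof -
    have "S = {}" if "S \<subseteq> {1..n}" "card S = 0" for S
      using that finite_subset[OF that(1)] by simp
    then show ?thesis by auto
  qed
  then show ?thesis by (simp add: subset_sum_def kappa_def)
qed

lemma subset_sum_eq_0: "n < k \<Longrightarrow> subset_sum q n k = 0"
proof -
  assume "n < k"
  then have "card S \<noteq> k" if "S \<subseteq> {1..n}" for S
    using card_mono[OF finite_atLeastAtMost that] by simp
  then have "{S. S \<subseteq> {1..n} \<and> card S = k} = {}" by blast
  then show ?thesis unfolding subset_sum_def by (simp only: sum.empty)
qed

lemma subset_sum_Suc: "subset_sum q (Suc n) (Suc k) = subset_sum q n (Suc k) + q ^ Suc n * subset_sum q n k"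
proof -
  let ?A = "\<lambda>(n::nat) k. {S. S \<subseteq> {1..n} \<and> card S = k}"
  have fin: "finite (?A n k)" for n k by (rule finite_subset[of _ "Pow {1..n}"]) auto
  have finS: "S \<subseteq> {1..n} \<Longrightarrow> finite S" for S by (rule finite_subset) auto
  have split: "?A (Suc n) (Suc k) = ?A n (Suc k) \<union> insert (Suc n) ` ?A n k"
  proof (intro equalityI subsetI)
    fix S assume S: "S \<in> ?A (Suc n) (Suc k)"
    show "S \<in> ?A n (Suc k) \<union> insert (Suc n) ` ?A n k"
    proof (cases "Suc n \<in> S")
      case True
      have "S - {Suc n} \<in> ?A n k" using S True by (auto simp: atLeastAtMostSuc_conv card_Diff_singleton_if)
      then show ?thesis using True by (intro UnI2 image_eqI[of _ _ "S - {Suc n}"]) auto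
    next
      case False
      then show ?thesis using S by (auto simp: atLeastAtMostSuc_conv)
    qed
  next
    fix S assume "S \<in> ?A n (Suc k) \<union> insert (Suc n) ` ?A n k"
    then show "S \<in> ?A (Suc n) (Suc k)"
    proof
      assume "S \<in> insert (Suc n) ` ?A n k"
      then obtain T where T: "S = insert (Suc n) T" "T \<subseteq> {1..n}" "card T = k" by auto
      then have "Suc n \<notin> T" by auto
      then show ?thesis using T finS[OF T(2)] by auto
    qed auto
  qed
  have disj: "?A n (Suc k) \<inter> insert (Suc n) ` ?A n k = {}" by auto
  have inj: "inj_on (insert (Suc n)) (?A n k)"
  proof (rule inj_onI)
    fix S T assume "S \<in> ?A n k" "T \<in> ?A n k" and eq: "insert (Suc n) S = insert (Suc n) T"
    then have "Suc n \<notin> S" "Suc n \<notin> T" by auto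
    then show "S = T" using eq by (metis insert_ident)
  qed
  have kap: "kappa (insert (Suc n) S) = Suc n + kappa S" if "S \<in> ?A n k" for S
  proof -
    have "Suc n \<notin> S" using that by auto
    then show ?thesis using that finS[of S] by (simp add: kappa_def)
  qed
  have "(\<Sum>S\<in>insert (Suc n) ` ?A n k. q ^ kappa S) = (\<Sum>S\<in>?A n k. q ^ Suc n * q ^ kappa S)"
    unfolding sum.reindex[OF inj] comp_def
    by (intro sum.cong refl) (simp only: kap power_add)
  then show ?thesis
    unfolding subset_sum_def split
    by (subst sum.union_disjoint[OF fin finite_imageI[OF fin] disj]) (simp only: sum_distrib_left)
qed

lemma sum_subset_sum_Suc:
  "(\<Sum>l\<le>Suc n. T l * subset_sum q (Suc n) l)
    = (\<Sum>l\<le>n. T l * subset_sum q n l) + q ^ Suc n * (\<Sum>l\<le>n. T (Suc l) * subset_sum q n l)"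
proof -
  have "(\<Sum>l\<le>Suc n. T l * subset_sum q (Suc n) l)
    = T 0 + (\<Sum>l\<le>n. T (Suc l) * subset_sum q n (Suc l)) + q ^ Suc n * (\<Sum>l\<le>n. T (Suc l) * subset_sum q n l)"
    by (simp add: sum.atMost_Suc_shift[of _ n] subset_sum_Suc algebra_simps sum.distrib sum_distrib_left del: sum.atMost_Suc)
  also have "T 0 + (\<Sum>l\<le>n. T (Suc l) * subset_sum q n (Suc l)) = (\<Sum>l\<le>Suc n. T l * subset_sum q n l)"
    by (simp add: sum.atMost_Suc_shift[of _ n] del: sum.atMost_Suc)
  also have "\<dots> = (\<Sum>l\<le>n. T l * subset_sum q n l)" by (simp add: subset_sum_eq_0)
  finally show ?thesis .
qed

text \<open>The source of the identity, for q other than 1: the alternating sum of z^l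
  \<open>subset_sum q n l\<close> is the product of the 1 - z q^i for i from 1 to n, and the
  Gaussian binomial is a combination of the q^(jl) with j at most k. So z runs through q^(-1), ...,
  q^(-k-1), all of them zeros since k < n. The proof itself is an induction in which passing from
  \<open>n\<close> to \<open>Suc n\<close> multiplies the sum by 1 - q^(n-k); this is 0 in the new
  case k = n.\<close>

lemma alternating_gauss_sum_eq_0:
  assumes "0 < q" "k < n"
  shows "(\<Sum>l\<le>n. (- 1) ^ l * gauss_binomial q l k * inverse q ^ (Suc k * l) * subset_sum q n l) = 0"
  using assms(2)
proof (induction n arbitrary: k)
  case (Suc n)
  define g where "g k = (\<Sum>l\<le>n. (- 1) ^ l * gauss_binomial q l k * inverse q ^ (Suc k * l) * subset_sum q n l)" for k
  have q: "q * inverse q = 1" using assms by simp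
  have step: "(\<Sum>l\<le>Suc n. (- 1) ^ l * gauss_binomial q l k * inverse q ^ (Suc k * l) * subset_sum q (Suc n) l)
    = g k + q ^ Suc n * (\<Sum>l\<le>n. (- 1) ^ Suc l * gauss_binomial q (Suc l) k * inverse q ^ (Suc k * Suc l) * subset_sum q n l)" for k
    using sum_subset_sum_Suc[of "\<lambda>l. (- 1) ^ l * gauss_binomial q l k * inverse q ^ (Suc k * l)" q n] by (simp only: g_def)
  show ?case
  proof (cases k)
    case 0
    have "(\<Sum>l\<le>n. (- 1) ^ Suc l * gauss_binomial q (Suc l) 0 * inverse q ^ (Suc 0 * Suc l) * subset_sum q n l)
      = - inverse q * g 0"
      unfolding g_def sum_distrib_left by (intro sum.cong) simp_all
    then have "(\<Sum>l\<le>Suc n. (- 1) ^ l * gauss_binomial q l 0 * inverse q ^ (Suc 0 * l) * subset_sum q (Suc n) l)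
      = g 0 * (1 - q ^ n * (q * inverse q))"
      unfolding step by (simp only:) (simp add: algebra_simps)
    also have "\<dots> = 0" using Suc.IH[of 0] by (cases "n = 0") (auto simp: q g_def)
    finally show ?thesis using 0 by simp
  next
    case [simp]: (Suc j)
    \<comment> \<open>Pascal's rule splits the shifted sum into those for \<open>j\<close> and for
      \<open>k\<close>. The power of \<open>q\<close> in the first part becomes independent of
      \<open>l\<close>: for \<open>j \<le> l\<close> the product
      \<open>q ^ (l - j) * inverse q ^ l\<close> is \<open>inverse q ^ j\<close>, and otherwise the
      binomial is 0.\<close>
    have trm: "(- 1) ^ Suc l * gauss_binomial q (Suc l) k * inverse q ^ (Suc k * Suc l) * subset_sum q n l
      = - (inverse q ^ Suc k) * (inverse q ^ j * ((- 1) ^ l * gauss_binomial q l j * inverse q ^ (Suc j * l) * subset_sum q n l)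
        + (- 1) ^ l * gauss_binomial q l k * inverse q ^ (Suc k * l) * subset_sum q n l)" for l
    proof -
      have "q ^ (l - j) * gauss_binomial q l j * inverse q ^ l = inverse q ^ j * gauss_binomial q l j"
      proof (cases "j \<le> l")
        case True
        then have "inverse q ^ l = inverse q ^ (l - j) * inverse q ^ j" by (simp flip: power_add)
        moreover have "q ^ (l - j) * inverse q ^ (l - j) = 1" using q by (simp flip: power_mult_distrib)
        ultimately show ?thesis by (simp add: mult_ac) 
      qed (simp add: gauss_binomial_eq_0)
      moreover have "inverse q ^ (Suc k * Suc l) = inverse q ^ Suc k * (inverse q ^ (Suc j * l) * inverse q ^ l)"
        "inverse q ^ (Suc k * l) = inverse q ^ (Suc j * l) * inverse q ^ l"
        by (simp_all add: algebra_simps flip: power_add)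
      moreover have "- A * (Z * X + Y) * (M * (P * L)) * s = - M * (J * (A * X * P * s) + A * Y * (P * L) * s)"
        if "Z * X * L = J * X" for A Z X Y M P L s J :: real
      proof -
        have "- A * (Z * X + Y) * (M * (P * L)) * s = - (A * M * P * s) * (Z * X * L) - A * Y * M * P * L * s"
          by (simp add: algebra_simps)
        then show ?thesis unfolding that by (simp add: algebra_simps)
      qed
      moreover have "(- 1) ^ Suc l = - ((- 1) ^ l :: real)" by simp
      moreover have "gauss_binomial q (Suc l) k = q ^ (l - j) * gauss_binomial q l j + gauss_binomial q l k" by simp
      ultimately show ?thesis by (simp only:)
    qed
    have "(\<Sum>l\<le>n. (- 1) ^ Suc l * gauss_binomial q (Suc l) k * inverse q ^ (Suc k * Suc l) * subset_sum q n l)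
      = - (inverse q ^ Suc k) * (inverse q ^ j * g j + g k)"
      unfolding trm g_def by (simp only: sum.distrib sum_distrib_left[symmetric])
    moreover have "g j = 0" unfolding g_def using Suc.IH[of j] Suc.prems by simp
    ultimately have "(\<Sum>l\<le>Suc n. (- 1) ^ l * gauss_binomial q l k * inverse q ^ (Suc k * l) * subset_sum q (Suc n) l)
      = g k * (1 - q ^ Suc n * inverse q ^ Suc k)"
      unfolding step by (simp only:) (simp add: algebra_simps)
    also have "\<dots> = 0"
    proof (cases "k < n")
      case True
      then show ?thesis unfolding g_def using Suc.IH[of k] by simp
    next
      case False
      then have "k = n" using Suc.prems by simp
      then show ?thesis using q by (simp del: power_Suc Suc flip: power_mult_distrib)
    qed
    finally show ?thesis .
  qed
qed simp

lemma subset_sum_full: "subset_sum q n n = q ^ (Suc n choose 2)"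
proof (induction n)
  case (Suc n)
  then show ?case by (simp add: subset_sum_Suc subset_sum_eq_0 numeral_2_eq_2 power_add)
qed (simp add: binomial_eq_0)

lemma gauss_binomial_self: "gauss_binomial q n n = 1"
  by (induction n) (auto simp: gauss_binomial_eq_0)

text \<open>The combinatorial identity behind the initial condition: with \<open>n\<close> the number of particles
  not to the right of \<open>x\<close>, the coefficients of the theorem reproduce \<open>x\<^sub>m \<le> x\<close>.\<close>
lemma gauss_sum_indicator:
  assumes "0 < q" "1 \<le> m" "n \<le> N"
  shows "(- 1) ^ m * q ^ (m choose 2) * (\<Sum>k=1..N. (- 1) ^ k * gauss_binomial q (k - 1) (m - 1)
    * inverse q ^ (m * k) * subset_sum q n k) = (if m \<le> n then 1 else 0)"
  using assms(3)
proof (induction n)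
  case 0
  have "(\<Sum>k=1..N. (- 1) ^ k * gauss_binomial q (k - 1) (m - 1) * inverse q ^ (m * k) * subset_sum q 0 k) = 0"
    by (intro sum.neutral) (auto simp: subset_sum_eq_0)
  then show ?case using assms(2) by simp
next
  case (Suc n)
  obtain j where m: "m = Suc j" using assms(2) by (cases m) auto
  define T where "T k = (- 1) ^ k * gauss_binomial q (k - 1) (m - 1) * inverse q ^ (m * k)" for k
  define g where "g = (\<Sum>l\<le>n. (- 1) ^ l * gauss_binomial q l j * inverse q ^ (Suc j * l) * subset_sum q n l)"
  have s1: "(\<Sum>k=1..N. T k * subset_sum q (Suc n) k)
    = (\<Sum>k=1..N. T k * subset_sum q n k) + (\<Sum>k=1..N. T k * (q ^ Suc n * subset_sum q n (k - 1)))"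
    unfolding sum.distrib[symmetric]
    by (intro sum.cong refl) (auto simp: distrib_left[symmetric] gr0_conv_Suc Suc_le_eq subset_sum_Suc simp del: power_Suc)
  have s2: "(\<Sum>k=1..N. T k * (q ^ Suc n * subset_sum q n (k - 1))) = - (q ^ Suc n * inverse q ^ m * g)"
  proof -
    have "(\<Sum>k=1..N. T k * (q ^ Suc n * subset_sum q n (k - 1))) = (\<Sum>l<N. T (Suc l) * (q ^ Suc n * subset_sum q n l))"
      by (rule sum.reindex_bij_witness[of _ Suc "\<lambda>k. k - 1"]) auto
    also have "\<dots> = (\<Sum>l\<le>n. T (Suc l) * (q ^ Suc n * subset_sum q n l))"
      by (rule sum.mono_neutral_right) (use Suc.prems in \<open>auto simp: subset_sum_eq_0\<close>)
    also have "\<dots> = - (q ^ Suc n * inverse q ^ m * g)"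
      unfolding g_def sum_distrib_left sum_negf[symmetric]
      by (intro sum.cong refl) (simp add: T_def m power_add algebra_simps)
    finally show ?thesis .
  qed
  \<comment> \<open>The increment from \<open>n\<close> to \<open>Suc n\<close> is a multiple of
    \<open>g\<close>. This vanishes by the alternating sum if \<open>j < n\<close> and term by term
    if \<open>j > n\<close>; for \<open>j = n\<close> only the last term survives, and the prefactor
    normalises the increment to 1.\<close>
  have s3: "- (q ^ Suc n * inverse q ^ m * g) * ((- 1) ^ m * q ^ (m choose 2)) = (if m = Suc n then 1 else 0)"
  proof (cases "m = Suc n")
    case True
    then have j: "j = n" using m by simp
    have "g = (\<Sum>l\<in>{n}. (- 1) ^ l * gauss_binomial q l j * inverse q ^ (Suc j * l) * subset_sum q n l)"
      unfolding g_def j by (rule sum.mono_neutral_right) (auto simp: gauss_binomial_eq_0)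
    then have g: "g = (- 1) ^ n * inverse q ^ (Suc n * n) * q ^ (m choose 2)"
      by (simp add: j gauss_binomial_self subset_sum_full True)
    have "q ^ (m choose 2) * q ^ (m choose 2) = q ^ (Suc n * n)"
    proof -
      have "(Suc n choose 2) + (Suc n choose 2) = Suc n * n" for n
        by (induction n) (simp_all add: numeral_2_eq_2)
      then have "(m choose 2) + (m choose 2) = Suc n * n"
        unfolding True .
      then show ?thesis by (simp only: power_add[symmetric])
    qed
    then have "g * q ^ (m choose 2) = (- 1) ^ n * (inverse q ^ (Suc n * n) * q ^ (Suc n * n))"
      unfolding g by (simp only: mult.assoc)
    also have "\<dots> = (- 1) ^ n" using assms(1) by (simp flip: power_mult_distrib)
    finally have "g * q ^ (m choose 2) = (- 1) ^ n" .
    have "- (q ^ Suc n * inverse q ^ m * g) * ((- 1) ^ m * q ^ (m choose 2))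
      = - (q ^ Suc n * inverse q ^ m) * (- 1) ^ m * (g * q ^ (m choose 2))" by (simp add: mult_ac del: power_Suc)
    also have "\<dots> = - 1 * (- 1) ^ m * (- 1) ^ n"
    proof -
      have "q ^ Suc n * inverse q ^ m = 1" using assms(1) True by (simp flip: power_mult_distrib del: power_Suc)
      then show ?thesis unfolding \<open>g * q ^ (m choose 2) = (- 1) ^ n\<close> by (simp only:)
    qed
    also have "- 1 * (- 1) ^ m * (- 1) ^ n = (1::real)" unfolding True by (simp flip: power_mult_distrib)
    finally show ?thesis unfolding if_P[OF True] .
  next
    case False
    have "g = 0"
    proof (cases "j < n")
      case True
      then show ?thesis unfolding g_def by (rule alternating_gauss_sum_eq_0[OF assms(1)])
    next
      case nj: False
      then show ?thesis unfolding g_def using False m by (intro sum.neutral) (auto simp: gauss_binomial_eq_0)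
    qed
    then show ?thesis using False by simp
  qed
  have "(- 1) ^ m * q ^ (m choose 2) * (\<Sum>k=1..N. T k * subset_sum q (Suc n) k)
    = (- 1) ^ m * q ^ (m choose 2) * (\<Sum>k=1..N. T k * subset_sum q n k) + (if m = Suc n then 1 else 0)"
    unfolding s1 s2 s3[symmetric] by (simp only: distrib_left mult.commute)
  also have "(- 1) ^ m * q ^ (m choose 2) * (\<Sum>k=1..N. T k * subset_sum q n k) = (if m \<le> n then 1 else 0)"
    unfolding T_def using Suc by simp
  finally show ?case unfolding T_def by auto
qed

section \<open>The law at time t\<close>

text \<open>During a push the activated particle stands on the site that its left neighbour has just
  taken, so strict order may fail at this one place. Jumps have positive length, so the next move
  restores it.\<close>

lemma set_pmf_hl_activate:
  assumes "ys \<in> set_pmf (hl_activate b xs i)" "length xs = N" "i < N"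
    and "\<And>l. Suc l < N \<Longrightarrow> Suc l \<noteq> i \<Longrightarrow> xs ! l < xs ! Suc l"
    and "0 < i \<Longrightarrow> xs ! (i - 1) \<le> xs ! i"
  shows "length ys = N \<and> (\<forall>l. Suc l < N \<longrightarrow> ys ! l < ys ! Suc l)"
  using assms
proof (induction "N - i" arbitrary: xs i)
  case (Suc n)
  from Suc.prems(1,2,3) obtain g where g: "ys \<in> set_pmf (if Suc i < N \<and> xs ! Suc i \<le> xs ! i + Suc g
      then hl_activate b (xs[i := xs ! Suc i]) (Suc i) else return_pmf (xs[i := xs ! i + Suc g]))"
    unfolding hl_activate.simps[of b xs i] by (auto simp: set_bind_pmf)
  have step: "xs ! l < xs ! Suc l" if "Suc l < N" "Suc l \<noteq> i" for l
    using Suc.prems(4) that .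
  show ?case
  proof (cases "Suc i < N \<and> xs ! Suc i \<le> xs ! i + Suc g")
    case True
    show ?thesis
    proof (rule Suc.hyps(1)[of "Suc i"])
      show "ys \<in> set_pmf (hl_activate b (xs[i := xs ! Suc i]) (Suc i))" using g True by simp
      show "(xs[i := xs ! Suc i]) ! l < (xs[i := xs ! Suc i]) ! Suc l" if "Suc l < N" "Suc l \<noteq> Suc i" for l
      proof (cases "Suc l = i")
        case True': True
        have "xs ! l \<le> xs ! i" using Suc.prems(5) True' by auto
        also have "\<dots> < xs ! Suc i" using step[of i] True by simp
        finally show ?thesis using True' Suc.prems(2) that by (simp add: nth_list_update)
      next
        case False
        then show ?thesis using step[of l] that Suc.prems(2) by (simp add: nth_list_update)
      qed
    qed (use Suc.hyps(2) Suc.prems True in auto)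
  next
    case False
    then have ys: "ys = xs[i := xs ! i + Suc g]" using g by auto
    have "ys ! l < ys ! Suc l" if l: "Suc l < N" for l
    proof -
      consider "l = i" | "Suc l = i" | "l \<noteq> i" "Suc l \<noteq> i" by blast
      then show ?thesis
      proof cases
        case 1
        then show ?thesis using False l Suc.prems(2) by (auto simp: ys nth_list_update)
      next
        case 2
        then have "xs ! l \<le> xs ! i" using Suc.prems(5) by auto
        then show ?thesis using 2 l Suc.prems(2) by (auto simp: ys nth_list_update)
      next
        case 3
        then show ?thesis using step[of l] l Suc.prems(2) by (simp add: ys nth_list_update)
      qed
    qed
    then show ?thesis using Suc.prems(2) by (simp add: ys)
  qed
qed simp

lemma sorted_wrt_less_iff_Suc:
  "sorted_wrt (<) (xs :: nat list) \<longleftrightarrow> (\<forall>l. Suc l < length xs \<longrightarrow> xs ! l < xs ! Suc l)"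
  by (auto simp: sorted_wrt_iff_nth_Suc_transp)

lemma set_pmf_hl_ring:
  assumes "ys \<in> set_pmf (hl_ring b xs)" "sorted_wrt (<) xs" "xs \<noteq> []"
  shows "length ys = length xs \<and> sorted_wrt (<) ys"
proof -
  from assms obtain i where i: "i < length xs" "ys \<in> set_pmf (hl_activate b xs i)"
    by (auto simp: hl_ring_def set_bind_pmf set_pmf_of_set lessThan_empty_iff)
  have s: "xs ! l < xs ! Suc l" if "Suc l < length xs" for l
    using assms(2) that by (simp add: sorted_wrt_less_iff_Suc)
  have "xs ! (i - 1) \<le> xs ! i" if "0 < i"
    using s[of "i - 1"] that i(1) by simp
  with set_pmf_hl_activate[OF i(2) refl i(1) s] show ?thesis
    by (simp add: sorted_wrt_less_iff_Suc)
qed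

text \<open>The Markov property in the form that splits off the first ring instead of the last, so
  that the induction over rings can vary the starting configuration.\<close>

lemma funpow_bind_pmf:
  fixes p :: "'a pmf" and R :: "'a \<Rightarrow> 'a pmf"
  shows "((\<lambda>p. bind_pmf p R) ^^ n) p = bind_pmf p (\<lambda>x. ((\<lambda>p. bind_pmf p R) ^^ n) (return_pmf x))"
proof (induction n)
  case (Suc n)
  have "((\<lambda>p. bind_pmf p R) ^^ Suc n) p = bind_pmf (((\<lambda>p. bind_pmf p R) ^^ n) p) R" for p :: "'a pmf"
    by simp
  then show ?case
    by (simp only: bind_assoc_pmf[symmetric] Suc.IH[symmetric])
qed (simp add: bind_return_pmf')

lemma prod_pairs_eq:
  fixes f :: "nat \<Rightarrow> nat \<Rightarrow> complex"
  assumes "finite S"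
  shows "(\<Prod>i\<in>S. \<Prod>j\<in>S. if i < j then f i j else 1) = (\<Prod>(i, j)\<in>pairs S. f i j)"
proof -
  have "(\<Prod>i\<in>S. \<Prod>j\<in>S. if i < j then f i j else 1) = (\<Prod>(i, j)\<in>S \<times> S. if i < j then f i j else 1)"
    by (rule prod.cartesian_product)
  also have "\<dots> = (\<Prod>(i, j)\<in>pairs S. f i j)"
    by (rule prod.mono_neutral_cong_right) (use assms in \<open>auto simp: pairs_def split: if_splits\<close>)
  finally show ?thesis .
qed

context hl_contours
begin

text \<open>The scalar by which one ring acts: the average of the one-particle factors over the
  uniformly chosen particle. A particle outside \<open>S\<close> does not occur in the integrand and
  contributes 1.\<close>

definition multiplier :: "nat \<Rightarrow> nat set \<Rightarrow> (nat \<Rightarrow> complex) \<Rightarrow> complex" where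
  "multiplier N S u = (\<Sum>i\<in>{1..N}. if i \<in> S then (1 - \<beta>) * u i / (1 - \<beta> * u i) else 1) / of_nat N"

lemma nice_multiplier [nice_intros]: "nice {} (multiplier N S)"
  unfolding multiplier_def [abs_def] divide_inverse[of _ "of_nat N"]
  by (intro nice_intros polydisc_1')

lemma multiplier_transpose:
  assumes "1 \<le> p" "Suc p \<le> N"
  shows "multiplier N (Transposition.transpose p (Suc p) ` S) u = multiplier N S (u \<circ> Transposition.transpose p (Suc p))"
proof -
  let ?\<tau> = "Transposition.transpose p (Suc p)"
  have "?\<tau> (?\<tau> i) \<in> ?\<tau> ` S \<longleftrightarrow> ?\<tau> i \<in> S" for i by (rule inj_image_mem_iff) simp
  then have "i \<in> ?\<tau> ` S \<longleftrightarrow> ?\<tau> i \<in> S" for i by simp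
  moreover have "?\<tau> i \<in> {1..N}" if "i \<in> {1..N}" for i using that assms by (auto simp: Transposition.transpose_def)
  ultimately show ?thesis
    unfolding multiplier_def
    by (intro arg_cong2[where f = "(/)"] refl sum.reindex_bij_witness[of _ ?\<tau> ?\<tau>]) auto
qed

lemma combination_sum:
  assumes "\<And>S. nice {} (h S)" "\<And>i S. i \<in> A \<Longrightarrow> nice {} (g i S)"
  shows "(\<Sum>i\<in>A. combination N x c (\<lambda>S u. h S u * g i S u) y) = combination N x c (\<lambda>S u. h S u * (\<Sum>i\<in>A. g i S u)) y"
proof -
  have "tmean S (\<lambda>u. weight x S u * (\<Prod>i\<in>S. u i ^ y i) * (h S u * (\<Sum>i\<in>A. g i S u)))
    = (\<Sum>i\<in>A. tmean S (\<lambda>u. weight x S u * (\<Prod>i\<in>S. u i ^ y i) * (h S u * g i S u)))" for S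
    unfolding sum_distrib_left
    by (rule tmean_sum) (intro nice_intros assms)
  then show ?thesis
    unfolding combination_def by (simp add: sum_distrib_left sum.swap[of _ A])
qed

lemma expectation_hl_ring:
  assumes "length y = N" "sorted_wrt (<) y" "0 < N"
  shows "measure_pmf.expectation (hl_ring b y) (\<lambda>ys. combination N x c (\<lambda>S u. multiplier N S u ^ n) (positions ys))
    = combination N x c (\<lambda>S u. multiplier N S u ^ Suc n) (positions y)"
proof -
  let ?\<phi> = "\<lambda>ys. combination N x c (\<lambda>S u. multiplier N S u ^ n) (positions ys)"
  have nice: "nice {} (\<lambda>u. multiplier N S u ^ n)" for S by (intro nice_intros)
  obtain B where B: "\<And>y. cmod (combination N x c (\<lambda>S u. multiplier N S u ^ n) y) \<le> B"
    using combination_bounded[of "\<lambda>S u. multiplier N S u ^ n" N x c, OF nice] by blast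
  let ?g = "\<lambda>i S u. if i \<in> S then (1 - \<beta>) * u i / (1 - \<beta> * u i) else 1"
  have "measure_pmf.expectation (hl_ring b y) ?\<phi>
      = (\<Sum>i<N. measure_pmf.expectation (hl_activate b y i) ?\<phi>) / of_nat N"
    unfolding hl_ring_def expectation_bind_pmf[OF B]
    using assms(1,3)
    by (subst integral_measure_pmf[of "{..<N}"])
      (auto simp: lessThan_empty_iff set_pmf_of_set pmf_of_set scaleR_conv_of_real sum_distrib_left divide_inverse mult.commute)
  also have "(\<Sum>i<N. measure_pmf.expectation (hl_activate b y i) ?\<phi>)
      = (\<Sum>i<N. combination N x c (\<lambda>S u. multiplier N S u ^ n * ?g (Suc i) S u) (positions y))"
    using assms(1,2)
    by (intro sum.cong refl expectation_hl_activate nice)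
      (auto simp: multiplier_transpose sorted_wrt_less_iff_Suc)
  also have "\<dots> = (\<Sum>i\<in>{1..N}. combination N x c (\<lambda>S u. multiplier N S u ^ n * ?g i S u) (positions y))"
    by (rule sum.reindex_bij_witness[of _ "\<lambda>i. i - 1" Suc]) auto
  also have "\<dots> = combination N x c (\<lambda>S u. multiplier N S u ^ n * (\<Sum>i\<in>{1..N}. ?g i S u)) (positions y)"
    by (rule combination_sum) (intro nice_intros polydisc_1')+
  also have "\<dots> / of_nat N = combination N x c (\<lambda>S u. multiplier N S u ^ Suc n) (positions y)"
  proof -
    have "tmean S (\<lambda>u. weight x S u * (\<Prod>i\<in>S. u i ^ y i) * multiplier N S u ^ Suc n)
      = inverse (of_nat N) * tmean S (\<lambda>u. weight x S u * (\<Prod>i\<in>S. u i ^ y i) * (multiplier N S u ^ n * (\<Sum>i\<in>{1..N}. ?g i S u)))"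
      for S and y :: "nat \<Rightarrow> nat"
      unfolding tmean_mult_left[symmetric]
      by (intro arg_cong2[where f = tmean] refl ext) (simp add: multiplier_def[of N S] divide_inverse mult_ac)
    from this[of _ "positions y"] show ?thesis
      unfolding combination_def sum_divide_distrib by (simp only: divide_inverse mult.assoc mult.left_commute mult.commute[of _ "inverse (of_nat N)"])
  qed
  finally show ?thesis .
qed

lemma expectation_iterated_ring:
  assumes init: "\<And>y. length y = N \<Longrightarrow> sorted_wrt (<) y \<Longrightarrow> f y = combination N x c (\<lambda>S u. 1) (positions y)"
    and "\<And>y. cmod (f y) \<le> B" "length y = N" "sorted_wrt (<) y" "0 < N"
  shows "measure_pmf.expectation (((\<lambda>p. bind_pmf p (hl_ring b)) ^^ n) (return_pmf y)) f
    = combination N x c (\<lambda>S u. multiplier N S u ^ n) (positions y)"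
  using assms(3,4)
proof (induction n arbitrary: y)
  case 0
  then show ?case by (simp add: init)
next
  case (Suc n)
  have "((\<lambda>p. bind_pmf p (hl_ring b)) ^^ Suc n) (return_pmf y)
    = bind_pmf (hl_ring b y) (\<lambda>ys. ((\<lambda>p. bind_pmf p (hl_ring b)) ^^ n) (return_pmf ys))"
    unfolding funpow_Suc_right comp_def
    by (subst funpow_bind_pmf) (simp add: bind_return_pmf)
  then have "measure_pmf.expectation (((\<lambda>p. bind_pmf p (hl_ring b)) ^^ Suc n) (return_pmf y)) f
    = measure_pmf.expectation (hl_ring b y) (\<lambda>ys. measure_pmf.expectation (((\<lambda>p. bind_pmf p (hl_ring b)) ^^ n) (return_pmf ys)) f)"
    by (simp only: expectation_bind_pmf[OF assms(2)])
  also have "\<dots> = measure_pmf.expectation (hl_ring b y) (\<lambda>ys. combination N x c (\<lambda>S u. multiplier N S u ^ n) (positions ys))"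
  \<comment> \<open>The induction hypothesis speaks of ordered configurations only;
    \<open>set_pmf_hl_ring\<close> shows that one ring almost surely leads to such a
    configuration.\<close>
  proof (rule integral_cong_AE)
    have "y \<noteq> []" using Suc.prems assms(5) by auto
    then show "AE ys in measure_pmf (hl_ring b y). measure_pmf.expectation (((\<lambda>p. bind_pmf p (hl_ring b)) ^^ n) (return_pmf ys)) f
        = combination N x c (\<lambda>S u. multiplier N S u ^ n) (positions ys)"
      using set_pmf_hl_ring[OF _ Suc.prems(2)] Suc.prems(1)
      unfolding AE_measure_pmf_iff by (intro ballI Suc.IH) auto
  qed simp_all
  also have "\<dots> = combination N x c (\<lambda>S u. multiplier N S u ^ Suc n) (positions y)"
    by (rule expectation_hl_ring[OF Suc.prems assms(5)])
  finally show ?case .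
qed

text \<open>The generating function of the Poisson law with mean N t, taken at
  \<open>multiplier N S u\<close> under the torus mean. Since \<open>multiplier\<close> is bounded
  on the torus, an exponential series dominates and summation and mean can be exchanged.\<close>

lemma expectation_hl_pushtasep_law:
  assumes init: "\<And>y. length y = N \<Longrightarrow> sorted_wrt (<) y \<Longrightarrow> f y = combination N x c (\<lambda>S u. 1) (positions y)"
    and f: "\<And>y. cmod (f y) \<le> B" and y: "length y = N" "sorted_wrt (<) y" "0 < N" and t: "0 < t"
  shows "measure_pmf.expectation (hl_pushtasep_law b t y) f
    = combination N x c (\<lambda>S u. exp (of_real (N * t) * (multiplier N S u - 1))) (positions y)"
proof -
  define \<mu> where "\<mu> = real N * t"
  have \<mu>: "0 < \<mu>" using t y(3) by (simp add: \<mu>_def)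
  let ?E = "\<lambda>n. combination N x c (\<lambda>S u. multiplier N S u ^ n) (positions y)"
  let ?it = "\<lambda>n. ((\<lambda>p. bind_pmf p (hl_ring b)) ^^ n) (return_pmf y)"
  have E: "measure_pmf.expectation (?it n) f = ?E n" for n
    by (rule expectation_iterated_ring[OF init f y])
  have bound: "cmod (?E n) \<le> B" for n
  proof -
    have "cmod (measure_pmf.expectation (?it n) f) \<le> B"
      using f by (intro order_trans[OF integral_norm_bound] measure_pmf.integral_le_const)
        (auto intro!: integrable_norm measure_pmf.integrable_const_bound[where B = B])
    then show ?thesis by (simp add: E)
  qed
  have "measure_pmf.expectation (hl_pushtasep_law b t y) f = measure_pmf.expectation (poisson_pmf \<mu>) ?E"
    unfolding hl_pushtasep_law_def expectation_bind_pmf[OF f] E y(1) \<mu>_def ..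
  with expectation_nat_pmf_sums[of ?E B "poisson_pmf \<mu>", OF bound]
  have 1: "(\<lambda>n. of_real (pmf (poisson_pmf \<mu>) n) * ?E n) sums measure_pmf.expectation (hl_pushtasep_law b t y) f"
    by simp
  have "(\<lambda>n. of_real (pmf (poisson_pmf \<mu>) n) * tmean S (\<lambda>u. weight x S u * (\<Prod>i\<in>S. u i ^ positions y i) * multiplier N S u ^ n))
     sums tmean S (\<lambda>u. weight x S u * (\<Prod>i\<in>S. u i ^ positions y i) * exp (of_real \<mu> * (multiplier N S u - 1)))" for S
  proof -
    define F where "F u = weight x S u * (\<Prod>i\<in>S. u i ^ positions y i) * of_real (exp (- \<mu>))" for u
    have nF: "nice {} F" unfolding F_def [abs_def] by (intro nice_intros)
    then obtain C where C: "0 < C" "\<And>u. u \<in> torus r \<Longrightarrow> cmod (F u) \<le> C"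
      by (rule nice_bounded) blast
    obtain M where M: "0 < M" "\<And>u. u \<in> torus r \<Longrightarrow> cmod (multiplier N S u) \<le> M"
      using nice_bounded[OF nice_multiplier] by metis
    have "(\<lambda>n. tmean S (\<lambda>u. F u * ((of_real \<mu> * multiplier N S u) ^ n /\<^sub>R fact n))) sums tmean S (\<lambda>u. F u * exp (of_real \<mu> * multiplier N S u))"
    proof (rule tmean_sums)
      show "nice {} (\<lambda>u. F u * ((of_real \<mu> * multiplier N S u) ^ n /\<^sub>R fact n))" for n
        unfolding scaleR_conv_of_real by (intro nice_intros nF)
      show "nice {} (\<lambda>u. F u * exp (of_real \<mu> * multiplier N S u))" by (intro nice_intros nF)
      fix u assume u: "u \<in> torus r"
      show "(\<lambda>n. F u * ((of_real \<mu> * multiplier N S u) ^ n /\<^sub>R fact n)) sums (F u * exp (of_real \<mu> * multiplier N S u))"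
        by (intro sums_mult exp_converges)
      have "cmod (of_real \<mu> * multiplier N S u) \<le> \<mu> * M"
        using \<mu> M(2)[OF u] by (simp add: norm_mult mult_left_mono)
      then have "cmod ((of_real \<mu> * multiplier N S u) ^ n /\<^sub>R fact n) \<le> (\<mu> * M) ^ n /\<^sub>R fact n" for n
        by (auto simp: norm_power intro!: divide_right_mono power_mono mult_left_mono simp del: norm_mult norm_of_real)
      then show "cmod (F u * ((of_real \<mu> * multiplier N S u) ^ n /\<^sub>R fact n)) \<le> C * ((\<mu> * M) ^ n /\<^sub>R fact n)" for n
        unfolding norm_mult[of "F u"] by (intro mult_mono C u) (use C(1) in auto)
    next
      show "summable (\<lambda>n. C * ((\<mu> * M) ^ n /\<^sub>R fact n))"
        by (intro summable_mult summable_exp_generic)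
    qed
    moreover have "tmean S (\<lambda>u. F u * ((of_real \<mu> * multiplier N S u) ^ n /\<^sub>R fact n))
      = of_real (pmf (poisson_pmf \<mu>) n) * tmean S (\<lambda>u. weight x S u * (\<Prod>i\<in>S. u i ^ positions y i) * multiplier N S u ^ n)" for n
      unfolding tmean_mult_left[symmetric]
      by (intro arg_cong2[where f = tmean] refl ext)
        (simp add: F_def pmf_poisson[OF \<mu>] power_mult_distrib scaleR_conv_of_real divide_inverse mult_ac)
    moreover have "tmean S (\<lambda>u. F u * exp (of_real \<mu> * multiplier N S u))
      = tmean S (\<lambda>u. weight x S u * (\<Prod>i\<in>S. u i ^ positions y i) * exp (of_real \<mu> * (multiplier N S u - 1)))"
      by (intro arg_cong2[where f = tmean] refl ext)
        (simp add: F_def right_diff_distrib exp_diff exp_minus divide_inverse exp_of_real[symmetric])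
    ultimately show ?thesis by simp
  qed
  then have "(\<lambda>n. \<Sum>S\<in>Pow {1..N}. c (card S) * \<beta> ^ kappa S * (of_real (pmf (poisson_pmf \<mu>) n)
      * tmean S (\<lambda>u. weight x S u * (\<Prod>i\<in>S. u i ^ positions y i) * multiplier N S u ^ n)))
    sums combination N x c (\<lambda>S u. exp (of_real \<mu> * (multiplier N S u - 1))) (positions y)"
    unfolding combination_def by (intro sums_sum sums_mult)
  then have "(\<lambda>n. of_real (pmf (poisson_pmf \<mu>) n) * ?E n)
    sums combination N x c (\<lambda>S u. exp (of_real \<mu> * (multiplier N S u - 1))) (positions y)"
    unfolding combination_def sum_distrib_left by (simp only: mult_ac)
  from sums_unique2[OF 1 this] show ?thesis by (simp add: \<mu>_def)
qed

section \<open>The initial condition\<close>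


lemma tmean_initial:
  assumes "finite S" "\<And>i j. i \<in> S \<Longrightarrow> j \<in> S \<Longrightarrow> i < j \<Longrightarrow> y i < y j"
  shows "tmean S (\<lambda>u. (\<Prod>(i, j)\<in>pairs S. K (u i) (u j)) * (\<Prod>i\<in>S. u i powi (int (y i) - x) / (1 - u i)))
    = (if \<forall>i\<in>S. int (y i) \<le> x then \<beta> ^ (card S choose 2) else 0)"
proof (cases "\<forall>i\<in>S. int (y i) \<le> x")
  case True
  have "(\<lambda>u. (\<Prod>(i, j)\<in>pairs S. K (u i) (u j)) * (\<Prod>i\<in>S. u i powi (int (y i) - x) / (1 - u i)))
    = (\<lambda>u. (\<Prod>(i, j)\<in>pairs S. K (u i) (u j)) * (\<Prod>i\<in>S. inverse (u i) ^ nat (x - int (y i)) / (1 - u i)))"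
    using True by (intro ext arg_cong2[where f = "(*)"] prod.cong refl) (auto simp: power_int_def)
  moreover have "nat (x - int (y j)) < nat (x - int (y i))" if "i \<in> S" "j \<in> S" "i < j" for i j
    using assms(2)[OF that] True that by auto
  ultimately show ?thesis
    using torus_mean_initial[of "sorted_list_of_set S" "\<lambda>i. nat (x - int (y i))" "\<lambda>_. of_real r"] True assms(1)
    by (simp add: tmean_def)
next
  case False
  then obtain i where "i \<in> S" "int (y i) - x > 0" by force
  then show ?thesis
    using torus_mean_initial_eq_0[of i "sorted_list_of_set S" "\<lambda>i. int (y i) - x" "\<lambda>_. of_real r"] False assms(1)
    by (auto simp: tmean_def)
qed

text \<open>Multiplication by the product of the \<open>u i\<close> replaces x by x - 1, so the
  factor 1 minus this product is a difference operator in x. It turns a formula for the distribution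
  function of a position into one for its point probabilities.\<close>

lemma tmean_weight_initial:
  assumes "finite S" "\<And>i j. i \<in> S \<Longrightarrow> j \<in> S \<Longrightarrow> i < j \<Longrightarrow> y i < y j"
  shows "tmean S (\<lambda>u. weight x S u * (\<Prod>i\<in>S. u i ^ y i))
    = (if \<forall>i\<in>S. int (y i) \<le> x then \<beta> ^ (card S choose 2) else 0)
      - (if \<forall>i\<in>S. int (y i) \<le> x - 1 then \<beta> ^ (card S choose 2) else 0)"
proof -
  let ?F = "\<lambda>x u. (\<Prod>(i, j)\<in>pairs S. K (u i) (u j)) * (\<Prod>i\<in>S. u i powi (int (y i) - x) / (1 - u i))"
  have nice: "nice {} (?F x)" for x
    unfolding case_prod_beta' by (intro nice_intros polydisc_1) auto
  have "tmean S (\<lambda>u. weight x S u * (\<Prod>i\<in>S. u i ^ y i)) = tmean S (\<lambda>u. ?F x u - ?F (x - 1) u)"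
  proof (rule tmean_cong)
    fix u assume u: "u \<in> torus r"
    let ?P = "\<Prod>i\<in>S. u i powi (int (y i) - x)"
    have P1: "?P = (\<Prod>i\<in>S. u i powi (- x)) * (\<Prod>i\<in>S. u i ^ y i)"
      unfolding prod.distrib[symmetric] using torus_nonzero[OF u]
      by (intro prod.cong refl) (simp add: power_int_diff power_int_minus field_simps)
    have P2: "(\<Prod>i\<in>S. u i powi (int (y i) - (x - 1))) = (\<Prod>i\<in>S. u i) * ?P"
      unfolding prod.distrib[symmetric] using torus_nonzero[OF u]
      by (intro prod.cong refl) (simp add: power_int_diff power_int_minus power_int_add field_simps)
    show "weight x S u * (\<Prod>i\<in>S. u i ^ y i) = ?F x u - ?F (x - 1) u"
      unfolding weight_def symm_part_def prod_dividef P2 P1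
      by (simp add: left_diff_distrib right_diff_distrib diff_divide_distrib mult_ac)
  qed
  also have "\<dots> = tmean S (?F x) - tmean S (?F (x - 1))"
    by (rule tmean_diff[OF nice nice])
  finally show ?thesis by (simp only: tmean_initial[OF assms])
qed

text \<open>The sign combines the theorem's (-1)^(m-1) with the (-1)^(k+1) that the inversion of the
  variables produces, and the last factor cancels the mean at time 0. The case \<open>k = 0\<close>
  is separate because the truncated \<open>k - 1\<close> would give the binomial the value 1 when
  \<open>m = 1\<close>.\<close>

definition coefficient :: "nat \<Rightarrow> nat \<Rightarrow> complex" where
  "coefficient m k = (if k = 0 then 0 else of_real ((- 1) ^ m * b ^ (m choose 2)
    * ((- 1) ^ k * gauss_binomial b (k - 1) (m - 1) * inverse b ^ (m * k)) * inverse b ^ (k choose 2)))"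

lemma sum_coefficient_subsets:
  assumes "n \<le> N" "1 \<le> m"
  shows "(\<Sum>S\<in>Pow {1..N}. coefficient m (card S) * \<beta> ^ kappa S * (if S \<subseteq> {1..n} then \<beta> ^ (card S choose 2) else 0))
    = (if m \<le> n then 1 else 0)"
proof -
  let ?C = "\<lambda>k. (- 1) ^ m * b ^ (m choose 2) * ((- 1) ^ k * gauss_binomial b (k - 1) (m - 1) * inverse b ^ (m * k))"
  have "(\<Sum>S\<in>Pow {1..N}. coefficient m (card S) * \<beta> ^ kappa S * (if S \<subseteq> {1..n} then \<beta> ^ (card S choose 2) else 0))
    = (\<Sum>S\<in>Pow {1..n}. coefficient m (card S) * \<beta> ^ kappa S * \<beta> ^ (card S choose 2))"
    by (rule sum.mono_neutral_cong_right) (use assms in auto)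
  also have "\<dots> = (\<Sum>S\<in>Pow {1..n}. of_real (if card S = 0 then 0 else ?C (card S) * b ^ kappa S))"
    using b_pos by (intro sum.cong refl) (auto simp: coefficient_def power_inverse)
  also have "\<dots> = (\<Sum>k\<in>{0..N}. \<Sum>S\<in>{S \<in> Pow {1..n}. card S = k}. of_real (if card S = 0 then 0 else ?C (card S) * b ^ kappa S))"
  proof (rule sum.group[symmetric])
    show "card ` Pow {1..n} \<subseteq> {0..N}"
    proof (rule image_subsetI)
      fix S assume "S \<in> Pow {1..n}"
      then have "card S \<le> card {1..n}" by (intro card_mono) simp_all
      then show "card S \<in> {0..N}" using assms(1) by simp
    qed
  qed simp_all
  also have "\<dots> = (\<Sum>k\<in>{1..N}. \<Sum>S\<in>{S \<in> Pow {1..n}. card S = k}. of_real (?C k * b ^ kappa S))"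
    by (rule sum.mono_neutral_cong_right) auto
  also have "\<dots> = of_real (\<Sum>k=1..N. ?C k * subset_sum b n k)"
    by (simp add: subset_sum_def sum_distrib_left)
  also have "(\<Sum>k=1..N. ?C k * subset_sum b n k) = (if m \<le> n then 1 else 0)"
    using gauss_sum_indicator[OF b_pos assms(2,1)] by (simp add: sum_distrib_left mult_ac)
  finally show ?thesis by simp
qed

lemma combination_initial:
  assumes y: "length y = N" "sorted_wrt (<) y" and m: "1 \<le> m" "m \<le> N"
  shows "combination N x (coefficient m) (\<lambda>S u. 1) (positions y) = (if int (y ! (m - 1)) = x then 1 else 0)"
proof -
  define n where "n x = card {i \<in> {1..N}. int (positions y i) \<le> x}" for x
  have mono: "positions y i < positions y j" if "i \<in> {1..N}" "j \<in> {1..N}" "i < j" for i j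
    using that y by (auto simp: positions_def sorted_wrt_iff_nth_less)
  have below: "{i \<in> {1..N}. int (positions y i) \<le> x} = {1..n x}" for x
  proof -
    let ?A = "{i \<in> {1..N}. int (positions y i) \<le> x}"
    \<comment> \<open>By the order of the particles, those not to the right of \<open>x\<close> form
      an initial segment. The inserted 0 covers the case that there is none, where
      \<open>{1..M}\<close> is empty.\<close>
    define M where "M = Max (insert 0 ?A)"
    have M: "M \<in> insert 0 ?A" unfolding M_def by (intro Max_in) auto
    have "?A = {1..M}"
    proof (intro equalityI subsetI)
      fix i assume i: "i \<in> {1..M}"
      with M have MA: "M \<in> ?A" by auto
      have "positions y i \<le> positions y M"
      proof (cases "i = M")
        case False
        then show ?thesis using mono[of i M] i MA by (intro less_imp_le) auto
      qed simp
      then show "i \<in> ?A" using MA i by auto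
    next
      fix i assume "i \<in> ?A"
      then show "i \<in> {1..M}" unfolding M_def by (auto intro: Max_ge)
    qed
    moreover from this have "n x = M" unfolding n_def by (simp only:) simp
    ultimately show ?thesis by (simp only:)
  qed
  have nN: "n x \<le> N" for x
  proof -
    have "{1..n x} \<subseteq> {1..N}" unfolding below[symmetric] by blast
    from card_mono[OF _ this] show ?thesis by simp
  qed
  have iff: "(\<forall>i\<in>S. int (positions y i) \<le> x) \<longleftrightarrow> S \<subseteq> {1..n x}" if "S \<in> Pow {1..N}" for S x
    using that unfolding below[symmetric] by blast
  have mn: "m \<le> n x \<longleftrightarrow> int (y ! (m - 1)) \<le> x" for x
  proof -
    have "m \<in> {1..n x} \<longleftrightarrow> m \<in> {i \<in> {1..N}. int (positions y i) \<le> x}" by (simp only: below)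
    then show ?thesis using m by (simp add: positions_def)
  qed
  let ?B = "\<lambda>x S. if S \<subseteq> {1..n x} then \<beta> ^ (card S choose 2) else 0"
  have "combination N x (coefficient m) (\<lambda>S u. 1) (positions y)
    = (\<Sum>S\<in>Pow {1..N}. coefficient m (card S) * \<beta> ^ kappa S * (?B x S - ?B (x - 1) S))"
    unfolding combination_def mult_1_right
  proof (intro sum.cong refl arg_cong2[where f = "(*)"])
    fix S assume S: "S \<in> Pow {1..N}"
    then have "finite S" by (auto intro: finite_subset)
    moreover have "positions y i < positions y j" if "i \<in> S" "j \<in> S" "i < j" for i j
      using mono that S by blast
    ultimately show "tmean S (\<lambda>u. weight x S u * (\<Prod>i\<in>S. u i ^ positions y i)) = ?B x S - ?B (x - 1) S"
      by (simp only: tmean_weight_initial iff[OF S])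
  qed
  also have "\<dots> = (if m \<le> n x then 1 else 0) - (if m \<le> n (x - 1) then 1 else 0)"
    unfolding right_diff_distrib sum_subtractf by (simp only: sum_coefficient_subsets[OF nN m(1)])
  finally show ?thesis by (auto simp: mn)
qed

section \<open>Return to the contour integrals of the theorem\<close>

lemma multi_circle_integral_hl_integrand:
  assumes S: "S \<subseteq> {1..N}" and N: "0 < N"
  shows "multi_circle_integral (1 / r) (sorted_list_of_set S) (hl_integrand b t y x S)
    = (- 1) ^ Suc (card S) * tmean S (\<lambda>u. weight x S u * (\<Prod>i\<in>S. u i ^ positions y i)
        * exp (of_real (N * t) * (multiplier N S u - 1)))"
proof -
  have fin: "finite S" using S by (rule finite_subset) auto
  let ?G = "\<lambda>u. hl_integrand b t y x S (\<lambda>i. inverse (u i)) * (\<Prod>i\<in>S. inverse (u i))"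
  have "multi_circle_integral (1 / r) (sorted_list_of_set S) (hl_integrand b t y x S)
    = torus_mean r (sorted_list_of_set S) ?G (\<lambda>_. 0)"
    using multi_circle_integral_eq_torus_mean[OF r_pos distinct_sorted_list_of_set, of S] fin by simp
  also have "\<dots> = tmean S ?G"
    unfolding tmean_def
  \<comment> \<open>\<open>multi_circle_integral\<close> starts from the zero assignment and
    \<open>tmean\<close> from a point of the torus; the integrand sees only the coordinates in
    \<open>S\<close>, all of which are overwritten.\<close>
  proof (rule torus_mean_base_cong[of "{}"])
    fix u v :: "nat \<Rightarrow> complex" assume "\<And>i. i \<in> {} \<union> set (sorted_list_of_set S) \<Longrightarrow> u i = v i"
    then have uv: "i \<in> S \<Longrightarrow> u i = v i" for i using fin by simp
    show "?G u = ?G v"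
      unfolding hl_integrand_def
      by (intro arg_cong2[where f = "(*)"] arg_cong2[where f = "(/)"] arg_cong2[where f = "(-)"] prod.cong refl)
        (simp_all add: uv)
  qed simp
  also have "\<dots> = tmean S (\<lambda>u. (- 1) ^ Suc (card S) * (weight x S u * (\<Prod>i\<in>S. u i ^ positions y i)
        * exp (of_real (N * t) * (multiplier N S u - 1))))"
  proof (rule tmean_cong)
    fix u assume u: "u \<in> torus r"
    note ne = torus_nonzero[OF u] polydisc_1[OF torus_polydisc[OF u]] polydisc_1'[OF torus_polydisc[OF u]]
    have kernel: "(\<Prod>i\<in>S. \<Prod>j\<in>S. if i < j then
         (inverse (u j) - inverse (u i)) / (1 - (1 + 1 / \<beta>) * inverse (u i) + (1 / \<beta>) * inverse (u i) * inverse (u j)) else 1)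
      = (\<Prod>(i, j)\<in>pairs S. K (u i) (u j))"
    proof -
      have "(inverse (u j) - inverse (u i)) / (1 - (1 + 1 / \<beta>) * inverse (u i) + (1 / \<beta>) * inverse (u i) * inverse (u j)) = K (u i) (u j)" for i j
      proof -
        have 1: "1 - (1 + 1 / \<beta>) * inverse (u i) + (1 / \<beta>) * inverse (u i) * inverse (u j) = D (u i) (u j) / (\<beta> * u i * u j)"
          using ne(1)[of i] ne(1)[of j] b_pos by (simp add: D_def field_simps)
        have 2: "inverse (u j) - inverse (u i) = (\<beta> * (u i - u j)) / (\<beta> * u i * u j)"
          using ne(1)[of i] ne(1)[of j] b_pos by (simp add: field_simps)
        show ?thesis unfolding 1 2 K_def using ne(1)[of i] ne(1)[of j] b_pos by simp
      qed
      then show ?thesis by (simp only: prod_pairs_eq[OF fin])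
    qed
    \<comment> \<open>Inversion changes the sign once in the numerator and once for each of the
      \<open>card S\<close> factors of the denominator; the products of the \<open>u i\<close>
      cancel.\<close>
    have sym: "(1 - (\<Prod>i\<in>S. inverse (u i))) / (\<Prod>i\<in>S. 1 - inverse (u i))
      = (- 1) ^ Suc (card S) * ((1 - (\<Prod>i\<in>S. u i)) / (\<Prod>i\<in>S. 1 - u i))"
    proof -
      have "(\<Prod>i\<in>S. 1 - inverse (u i)) = (\<Prod>i\<in>S. (- 1) * ((1 - u i) / u i))"
        using ne(1) by (intro prod.cong refl) (simp add: field_simps)
      also have "\<dots> = (- 1) ^ card S * ((\<Prod>i\<in>S. 1 - u i) / (\<Prod>i\<in>S. u i))"
        by (simp only: prod.distrib prod_constant prod_dividef)
      finally have 1: "(\<Prod>i\<in>S. 1 - inverse (u i)) = (- 1) ^ card S * ((\<Prod>i\<in>S. 1 - u i) / (\<Prod>i\<in>S. u i))" .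
      have U: "(\<Prod>i\<in>S. u i) \<noteq> 0" "(\<Prod>i\<in>S. 1 - u i) \<noteq> 0" using ne fin by auto
      have 2: "1 - (\<Prod>i\<in>S. inverse (u i)) = - (1 - (\<Prod>i\<in>S. u i)) / (\<Prod>i\<in>S. u i)"
      proof -
        have "(\<Prod>i\<in>S. inverse (u i)) = inverse (\<Prod>i\<in>S. u i)"
          using prod_inversef[of u S] by (simp add: comp_def)
        then show ?thesis using U by (simp add: field_simps del: prod_inversef)
      qed
      have "(- 1) ^ card S * (- 1) ^ card S = (1::complex)" by (simp flip: power_mult_distrib)
      then have 3: "inverse ((- 1) ^ card S) = ((- 1) ^ card S :: complex)" by (rule inverse_unique)
      have "(- A / P) / (e * (Q / P)) = - inverse e * (A / Q)" if "P \<noteq> 0" for A P Q e :: complex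
        using that by (simp add: divide_inverse)
      from this[OF U(1)] show ?thesis unfolding 1 2 power_Suc mult_minus1 by (simp only: 3)
    qed
    \<comment> \<open>The last product stems from the differentials and cancels the -1 in the
      exponent of the powers. In the exponential, indices outside \<open>S\<close> contribute 0 to
      \<open>multiplier N S u - 1\<close>, and its denominator \<open>N\<close> cancels against
      \<open>N * t\<close>.\<close>
    have pow: "(\<Prod>i\<in>S. inverse (u i) powi (x - int (y ! (i - 1)) - 1)
          * exp (- of_real t * (1 - 1 / inverse (u i)) / (1 - \<beta> / inverse (u i)))) * (\<Prod>i\<in>S. inverse (u i))
      = (\<Prod>i\<in>S. u i powi (- x)) * (\<Prod>i\<in>S. u i ^ positions y i) * exp (of_real (N * t) * (multiplier N S u - 1))"
    proof -
      let ?l = "\<lambda>i. (1 - \<beta>) * u i / (1 - \<beta> * u i)"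
      have "multiplier N S u - 1 = (\<Sum>i\<in>{1..N}. (if i \<in> S then ?l i else 1) - 1) / of_nat N"
        using N by (simp add: multiplier_def sum_subtractf diff_divide_distrib)
      also have "(\<Sum>i\<in>{1..N}. (if i \<in> S then ?l i else 1) - 1) = (\<Sum>i\<in>S. ?l i - 1)"
        by (rule sum.mono_neutral_cong_right) (use S in auto)
      finally have "of_real (N * t) * (multiplier N S u - 1) = (\<Sum>i\<in>S. of_real t * (?l i - 1))"
        unfolding sum_distrib_left[symmetric] using N by simp
      then have e: "exp (of_real (N * t) * (multiplier N S u - 1)) = (\<Prod>i\<in>S. exp (of_real t * (?l i - 1)))"
        by (simp add: exp_sum[OF fin])
      show ?thesis
        unfolding e prod.distrib[symmetric]
      proof (intro prod.cong refl)
        fix i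
        have "inverse (u i) powi (x - int (y ! (i - 1)) - 1) * inverse (u i) = inverse (u i) powi (x - int (y ! (i - 1)))"
          using ne(1)[of i] by (simp add: power_int_diff)
        also have "\<dots> = u i powi (- x) * u i ^ positions y i"
          using ne(1)[of i] by (simp add: power_int_diff power_int_minus power_int_inverse positions_def field_simps)
        finally have 1: "inverse (u i) powi (x - int (y ! (i - 1)) - 1) * inverse (u i) = u i powi (- x) * u i ^ positions y i" .
        have "- of_real t * (1 - 1 / inverse (u i)) / (1 - \<beta> / inverse (u i)) = of_real t * (- (1 - u i) / (1 - \<beta> * u i))"
          by (simp add: divide_inverse algebra_simps)
        also have "- (1 - u i) / (1 - \<beta> * u i) = ?l i - 1"
        proof -
          have "- (1 - u i) = (1 - \<beta>) * u i - (1 - \<beta> * u i)" by (simp add: algebra_simps)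
          then show ?thesis using divide_self[OF ne(3)[of i]]
            by (simp only: diff_divide_distrib[of "(1 - \<beta>) * u i" "1 - \<beta> * u i"])
        qed
        finally have 2: "- of_real t * (1 - 1 / inverse (u i)) / (1 - \<beta> / inverse (u i)) = of_real t * (?l i - 1)" .
        show "inverse (u i) powi (x - int (y ! (i - 1)) - 1)
            * exp (- of_real t * (1 - 1 / inverse (u i)) / (1 - \<beta> / inverse (u i))) * inverse (u i)
          = u i powi (- x) * u i ^ positions y i * exp (of_real t * (?l i - 1))"
          unfolding 2 1[symmetric] by (simp only: mult_ac)
      qed
    qed
    show "?G u = (- 1) ^ Suc (card S) * (weight x S u * (\<Prod>i\<in>S. u i ^ positions y i)
        * exp (of_real (N * t) * (multiplier N S u - 1)))"
      unfolding hl_integrand_def kernel sym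
      unfolding mult.assoc pow[unfolded mult.assoc] weight_def symm_part_def
      by (simp only: mult_ac)
  qed
  also have "\<dots> = (- 1) ^ Suc (card S) * tmean S (\<lambda>u. weight x S u * (\<Prod>i\<in>S. u i ^ positions y i)
        * exp (of_real (N * t) * (multiplier N S u - 1)))"
    by (rule tmean_mult_left)
  finally show ?thesis .
qed

lemma prob_eq_contour_integrals:
  assumes t: "0 < t" and y: "length y = N" "sorted_wrt (<) y" and m: "1 \<le> m" "m \<le> N"
  shows "complex_of_real (measure_pmf.prob (hl_pushtasep_law b t y) {xs. int (xs ! (m - 1)) = x})
    = (-1) ^ (m - 1) * of_real (b powi int (m * (m - 1) div 2)) *
      (\<Sum>k=m..N. \<Sum>S\<in>{S. S \<subseteq> {1..N} \<and> card S = k}.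
         of_real (b powi (int (kappa S) - int (m * k) - int (k * (k - 1) div 2)))
         * of_real (qbinom b (k - 1) (m - 1))
         * multi_circle_integral (1 / r) (sorted_list_of_set S) (hl_integrand b t y x S))"
proof -
  have N: "0 < N" using m by simp
  let ?f = "\<lambda>xs. if int (xs ! (m - 1)) = x then 1 else 0 :: complex"
  let ?h = "\<lambda>S u. exp (of_real (N * t) * (multiplier N S u - 1))"
  let ?T = "\<lambda>S. tmean S (\<lambda>u. weight x S u * (\<Prod>i\<in>S. u i ^ positions y i) * ?h S u)"
  have "complex_of_real (measure_pmf.prob (hl_pushtasep_law b t y) {xs. int (xs ! (m - 1)) = x})
    = measure_pmf.expectation (hl_pushtasep_law b t y) (\<lambda>xs. complex_of_real (indicator {xs. int (xs ! (m - 1)) = x} xs))"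
    unfolding integral_complex_of_real by simp
  also have "\<dots> = measure_pmf.expectation (hl_pushtasep_law b t y) ?f"
    by (intro Bochner_Integration.integral_cong) (auto simp: indicator_def)
  also have "\<dots> = combination N x (coefficient m) ?h (positions y)"
    by (rule expectation_hl_pushtasep_law[where B = 1]) (use combination_initial m y N t in auto)
  also have "\<dots> = (\<Sum>k\<in>{0..N}. \<Sum>S\<in>{S \<in> Pow {1..N}. card S = k}. coefficient m (card S) * \<beta> ^ kappa S * ?T S)"
    unfolding combination_def
  proof (rule sum.group[symmetric])
    show "card ` Pow {1..N} \<subseteq> {0..N}"
    proof (rule image_subsetI)
      fix S assume "S \<in> Pow {1..N}"
      then have "card S \<le> card {1..N}" by (intro card_mono) simp_all
      then show "card S \<in> {0..N}" by simp
    qed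
  qed simp_all
  also have "\<dots> = (\<Sum>k=m..N. \<Sum>S\<in>{S. S \<subseteq> {1..N} \<and> card S = k}. coefficient m k * \<beta> ^ kappa S * ?T S)"
  \<comment> \<open>Sizes below \<open>m\<close> drop out: for \<open>0 < k\<close> the Gaussian
    binomial is 0, and for \<open>k = 0\<close> the coefficient is 0 by definition.\<close>
  proof (rule sum.mono_neutral_cong_right)
    show "\<forall>k\<in>{0..N} - {m..N}. (\<Sum>S\<in>{S \<in> Pow {1..N}. card S = k}. coefficient m (card S) * \<beta> ^ kappa S * ?T S) = 0"
      by (auto simp: coefficient_def gauss_binomial_eq_0 intro!: sum.neutral)
  qed (auto intro!: sum.cong)
  also have "\<dots> = (\<Sum>k=m..N. \<Sum>S\<in>{S. S \<subseteq> {1..N} \<and> card S = k}.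
      (-1) ^ (m - 1) * of_real (b powi int (m * (m - 1) div 2)) *
      (of_real (b powi (int (kappa S) - int (m * k) - int (k * (k - 1) div 2)))
         * of_real (qbinom b (k - 1) (m - 1))
         * multi_circle_integral (1 / r) (sorted_list_of_set S) (hl_integrand b t y x S)))"
  proof (intro sum.cong refl)
    fix k S assume k: "k \<in> {m..N}" and S: "S \<in> {S. S \<subseteq> {1..N} \<and> card S = k}"
    have b0: "b \<noteq> 0" using b_pos by simp
    have "b powi (int (kappa S) - int (m * k) - int (k * (k - 1) div 2))
      = b ^ kappa S * inverse b ^ (m * k) * inverse b ^ (k choose 2)"
      unfolding choose_two power_int_diff[OF disjI1[OF b0]] power_int_of_nat by (simp only: divide_inverse power_inverse)
    moreover have "b powi int (m * (m - 1) div 2) = b ^ (m choose 2)"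
      by (simp only: choose_two power_int_of_nat)
    moreover have "qbinom b (k - 1) (m - 1) = gauss_binomial b (k - 1) (m - 1)"
      using k by (intro qbinom_eq_gauss_binomial b_pos b_less_1) auto
    moreover have "(- 1) ^ m * (- 1) ^ k = ((-1) ^ (m - 1) * (- 1) ^ Suc k :: complex)"
      using m by (cases m) auto
    moreover have "multi_circle_integral (1 / r) (sorted_list_of_set S) (hl_integrand b t y x S) = (- 1) ^ Suc k * ?T S"
      using multi_circle_integral_hl_integrand[of S N t y x] S N by simp
    moreover have "coefficient m k * \<beta> ^ kappa S * ?T S = ((- 1) ^ m * (- 1) ^ k) * (\<beta> ^ (m choose 2)
        * (of_real (gauss_binomial b (k - 1) (m - 1)) * inverse \<beta> ^ (m * k)) * inverse \<beta> ^ (k choose 2)) * \<beta> ^ kappa S * ?T S"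
      using k m by (simp add: coefficient_def mult_ac)
    ultimately show "coefficient m k * \<beta> ^ kappa S * ?T S = (-1) ^ (m - 1) * of_real (b powi int (m * (m - 1) div 2)) *
      (of_real (b powi (int (kappa S) - int (m * k) - int (k * (k - 1) div 2)))
         * of_real (qbinom b (k - 1) (m - 1))
         * multi_circle_integral (1 / r) (sorted_list_of_set S) (hl_integrand b t y x S))"
      by (simp only: of_real_mult of_real_power of_real_inverse mult_ac)
  qed
  finally show ?thesis by (simp only: sum_distrib_left)
qed

end

theorem theorem3p3:
  fixes b t :: real and N m :: nat and y :: "nat list" and x :: int
  assumes "0 < b" "b < 1" "0 < N" "0 < t"
    and "length y = N" "sorted_wrt (<) y"
    and "1 \<le> m" "m \<le> N"
  shows "\<forall>\<^sub>F R in at_top.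
    complex_of_real (measure_pmf.prob (hl_pushtasep_law b t y) {xs. int (xs ! (m - 1)) = x})
    = (-1) ^ (m - 1) * of_real (b powi int (m * (m - 1) div 2)) *
      (\<Sum>k=m..N. \<Sum>S\<in>{S. S \<subseteq> {1..N} \<and> card S = k}.
         of_real (b powi (int (kappa S) - int (m * k) - int (k * (k - 1) div 2)))
         * of_real (qbinom b (k - 1) (m - 1))
         * multi_circle_integral R (sorted_list_of_set S) (hl_integrand b t y x S))"
proof (rule eventually_mono[OF eventually_gt_at_top[of 3]])
  \<comment> \<open>The threshold 3 is the reciprocal of the bound 1/3 on \<open>r\<close> and is
    the same for all values of the parameters.\<close>
  fix R :: real assume R: "3 < R"
  then interpret hl_contours b "1 / R"
    using assms(1,2) by unfold_locales (auto simp: field_simps)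
  show "complex_of_real (measure_pmf.prob (hl_pushtasep_law b t y) {xs. int (xs ! (m - 1)) = x})
    = (-1) ^ (m - 1) * of_real (b powi int (m * (m - 1) div 2)) *
      (\<Sum>k=m..N. \<Sum>S\<in>{S. S \<subseteq> {1..N} \<and> card S = k}.
         of_real (b powi (int (kappa S) - int (m * k) - int (k * (k - 1) div 2)))
         * of_real (qbinom b (k - 1) (m - 1))
         * multi_circle_integral R (sorted_list_of_set S) (hl_integrand b t y x S))"
    using prob_eq_contour_integrals[OF assms(4-8), of x] by simp
qed

end
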